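(* Let $n\ge2$. For any $c\in W_{A_{2n}^{(2)}}^0=\mathcal C_{2n}^s$, we have $$L_{A_{2n}^{(2)}}(c)=\frac12\big(L(c)+a_0(c)\big).$$
   Context: A $2n$-core is a partition having no hook length equal to $2n$; $\mathcal C_{2n}$ is the set of $2n$-cores and $\mathcal C_{2n}^s$ the subset of self-conjugate ones. The box in row $i$, column $j$ has residue $(j-i)\bmod 2n$; boxes of residue $i$ are $i$-nodes. The affine Weyl group $\widetilde{\mathfrak S}_{2n}$ of type $A_{2n-1}^{(1)}$, with simple reflections $s_0,\dots,s_{2n-1}$, acts on $\mathcal C_{2n}$: $s_i\cdot c$ is obtained by removing all removable $i$-nodes of $c$ if there are some, adding all addable $i$-nodes if there are some, and $s_i\cdot c=c$ otherwise. $L(c)$ denotes the number of boxes of $c$ and $a_i(c)$ the number of boxes of $c$ of residue $i$. Let $\alpha_0,\dots,\alpha_{2n-1}$ and $\Lambda_0,\dots,\Lambda_{2n-1}$ be the simple roots and fundamental weights of the affine root system of type $A_{2n-1}^{(1)}$, on which $\widetilde{\mathfrak S}_{2n}$ acts by $s_i(x)=x-\langle x,\alpha_i^\vee\rangle\alpha_i$. The affine root system of type $A_{2n}^{(2)}$ is realized by $\alpha_0^{A_{2n}^{(2)}}=\alpha_0$, $\alpha_i^{A_{2n}^{(2)}}=\alpha_i+\alpha_{2n-i}$ ($1\le i\le n-1$), $\alpha_n^{A_{2n}^{(2)}}=2\alpha_n$, $\Lambda_0^{A_{2n}^{(2)}}=\Lambda_0$, and its Weyl group $W_{A_{2n}^{(2)}}$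 as the subgroup of $\widetilde{\mathfrak S}_{2n}$ generated by $s_0$, $s_is_{2n-i}$ ($1\le i\le n-1$), $s_n$. The affine Grassmannian $W_{A_{2n}^{(2)}}^0$ (minimal length representatives of left cosets modulo the finite Weyl group generated by all these generators except $s_0$) is identified with $\mathcal C_{2n}^s$ via $w\mapsto w\cdot\varnothing$. The atomic length: for $w\in W_{A_{2n}^{(2)}}^0$ with $c=w\cdot\varnothing$, write $\Lambda_0^{A_{2n}^{(2)}}-w(\Lambda_0^{A_{2n}^{(2)}})=\sum_{i=0}^n a_i^{A_{2n}^{(2)}}(c)\,\alpha_i^{A_{2n}^{(2)}}$; then $L_{A_{2n}^{(2)}}(c)=\sum_{i=0}^n a_i^{A_{2n}^{(2)}}(c)$. *)

theory Defs
  imports "HOL-Algebra.Algebra" "HOL-Library.Function_Algebras"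
begin

section \<open>Partitions and cores\<close>

text \<open>A partition is represented by its Young diagram, i.e. the set of its boxes (row, column).
  Rows and columns are numbered from 0, which changes neither residues nor hook lengths.\<close>

type_synonym box = "nat \<times> nat"

definition is_partition :: "box set \<Rightarrow> bool" where
  "is_partition c \<longleftrightarrow> finite c \<and> (\<forall>(i, j) \<in> c. \<forall>i' \<le> i. \<forall>j' \<le> j. (i', j') \<in> c)"

definition hook_length :: "box set \<Rightarrow> box \<Rightarrow> nat" where
  "hook_length c = (\<lambda>(i, j).
     card {j'. j < j' \<and> (i, j') \<in> c} + card {i'. i < i' \<and> (i', j) \<in> c} + 1)"

definition cores :: "nat \<Rightarrow> box set set" where
  "cores m = {c. is_partition c \<and> (\<forall>b \<in> c. hook_length c b \<noteq> m)}"

definition self_conjugate :: "box set \<Rightarrow> bool" where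
  "self_conjugate c \<longleftrightarrow> prod.swap ` c = c"

definition self_conjugate_cores :: "nat \<Rightarrow> box set set" where
  "self_conjugate_cores m = {c \<in> cores m. self_conjugate c}"

definition residue :: "nat \<Rightarrow> box \<Rightarrow> nat" where
  "residue m = (\<lambda>(i, j). nat ((int j - int i) mod int m))"

definition res_count :: "nat \<Rightarrow> nat \<Rightarrow> box set \<Rightarrow> nat" where
  "res_count m i c = card {b \<in> c. residue m b = i}"

definition addable_nodes :: "nat \<Rightarrow> nat \<Rightarrow> box set \<Rightarrow> box set" where
  "addable_nodes m i c = {b. b \<notin> c \<and> is_partition (insert b c) \<and> residue m b = i}"

definition removable_nodes :: "nat \<Rightarrow> nat \<Rightarrow> box set \<Rightarrow> box set" where
  "removable_nodes m i c = {b \<in> c. is_partition (c - {b}) \<and> residue m b = i}"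

definition core_reflection :: "nat \<Rightarrow> nat \<Rightarrow> box set \<Rightarrow> box set" where
  "core_reflection m i c =
     (if removable_nodes m i c \<noteq> {} then c - removable_nodes m i c
      else if addable_nodes m i c \<noteq> {} then c \<union> addable_nodes m i c
      else c)"


section \<open>The affine root system of type $A_{m-1}^{(1)}$ ($m \ge 3$)\<close>

text \<open>The weight space has basis $\Lambda_0,\dots,\Lambda_{m-1},\delta$. A weight is given by its
  coordinates: coordinate i < m is the coefficient of $\Lambda_i$, hence the pairing with
  $\alpha_i^\vee$, and coordinate m is the coefficient of $\delta$. Coordinates above m are not
  used: they vanish on all roots and fundamental weights and are fixed by all reflections.
  The simple roots are $\alpha_j = \sum_i \langle\alpha_j,\alpha_i^\vee\rangle\Lambda_i$, plus
  $\delta$ if $j = 0$, so that $\delta = \alpha_0 + \dots + \alpha_{m-1}$.\<close>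

type_synonym weight = "nat \<Rightarrow> real"

definition scale :: "real \<Rightarrow> weight \<Rightarrow> weight" (infixr "*\<^sub>w" 75) where
  "r *\<^sub>w x = (\<lambda>k. r * x k)"

definition coroot_pairing :: "weight \<Rightarrow> nat \<Rightarrow> real" where
  "coroot_pairing x i = x i"

definition cartan :: "nat \<Rightarrow> nat \<Rightarrow> nat \<Rightarrow> real" where
  "cartan m i j =
     (if i = j then 2 else if j = (i + 1) mod m \<or> i = (j + 1) mod m then -1 else 0)"

definition fund_weight :: "nat \<Rightarrow> weight" where
  "fund_weight i = (\<lambda>k. if k = i then 1 else 0)"

definition simple_root :: "nat \<Rightarrow> nat \<Rightarrow> weight" where
  "simple_root m j =
     (\<lambda>k. if k < m then cartan m k j else if k = m \<and> j = 0 then 1 else 0)"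

definition simple_reflection :: "nat \<Rightarrow> nat \<Rightarrow> weight \<Rightarrow> weight" where
  "simple_reflection m i x = x - coroot_pairing x i *\<^sub>w simple_root m i"

definition affine_weyl :: "nat \<Rightarrow> (weight \<Rightarrow> weight) monoid" where
  "affine_weyl m = subgroup_generated (BijGroup UNIV) (simple_reflection m ` {..<m})"

definition word_prod :: "('a, 'b) monoid_scheme \<Rightarrow> (nat \<Rightarrow> 'a) \<Rightarrow> nat list \<Rightarrow> 'a" where
  "word_prod G g is = foldr (\<lambda>i w. g i \<otimes>\<^bsub>G\<^esub> w) is \<one>\<^bsub>G\<^esub>"

text \<open>The action of the affine Weyl group on m-cores extending the action of the simple
  reflections: a word for w acts letter by letter, the rightmost letter first.
  The result does not depend on the word.\<close>

definition core_action :: "nat \<Rightarrow> (weight \<Rightarrow> weight) \<Rightarrow> box set \<Rightarrow> box set" where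
  "core_action m w c =
     (THE d. \<exists>is. set is \<subseteq> {..<m} \<and>
        w = word_prod (affine_weyl m) (simple_reflection m) is \<and>
        d = foldr (core_reflection m) is c)"


section \<open>The affine root system of type $A_{2n}^{(2)}$ ($n \ge 2$)\<close>

definition A2_root :: "nat \<Rightarrow> nat \<Rightarrow> weight" where
  "A2_root n i =
     (if i = 0 then simple_root (2*n) 0
      else if i = n then 2 *\<^sub>w simple_root (2*n) n
      else simple_root (2*n) i + simple_root (2*n) (2*n - i))"

definition A2_fund_weight0 :: weight where
  "A2_fund_weight0 = fund_weight 0"

definition A2_gen :: "nat \<Rightarrow> nat \<Rightarrow> weight \<Rightarrow> weight" where
  "A2_gen n i =
     (if i = 0 \<or> i = n then simple_reflection (2*n) i
      else simple_reflection (2*n) i \<otimes>\<^bsub>affine_weyl (2*n)\<^esub> simple_reflection (2*n) (2*n - i))"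

definition A2_weyl :: "nat \<Rightarrow> (weight \<Rightarrow> weight) monoid" where
  "A2_weyl n = subgroup_generated (affine_weyl (2*n)) (A2_gen n ` {0..n})"

definition A2_finite_weyl :: "nat \<Rightarrow> (weight \<Rightarrow> weight) monoid" where
  "A2_finite_weyl n = subgroup_generated (affine_weyl (2*n)) (A2_gen n ` {1..n})"

text \<open>Coxeter length with respect to the generators above; these are involutions, so words need
  no inverses.\<close>

definition A2_length :: "nat \<Rightarrow> (weight \<Rightarrow> weight) \<Rightarrow> nat" where
  "A2_length n w =
     (LEAST k. \<exists>is. length is = k \<and> set is \<subseteq> {0..n} \<and> w = word_prod (A2_weyl n) (A2_gen n) is)"

definition A2_grassmannian :: "nat \<Rightarrow> (weight \<Rightarrow> weight) set" where
  "A2_grassmannian n =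
     {w \<in> carrier (A2_weyl n).
        \<forall>v \<in> w <#\<^bsub>A2_weyl n\<^esub> carrier (A2_finite_weyl n). A2_length n w \<le> A2_length n v}"

text \<open>The atomic length of a self-conjugate 2n-core c, identified with the affine Grassmannian
  element w such that c is the image of the empty partition under w. The coefficients are real,
  so nothing about their integrality is presupposed; they are unique because the roots are
  linearly independent.\<close>

definition A2_atomic_length :: "nat \<Rightarrow> box set \<Rightarrow> real" where
  "A2_atomic_length n c =
     (THE l. \<exists>w \<in> A2_grassmannian n. core_action (2*n) w {} = c \<and>
        (\<exists>a. A2_fund_weight0 - w A2_fund_weight0 = (\<Sum>i=0..n. a i *\<^sub>w A2_root n i) \<and>
             l = (\<Sum>i=0..n. a i)))"

end

theory Submission
  imports Defs
begin

text \<open>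
  Attach to a core $c$ the weight $\mathrm{wt}(c) = \Lambda_0 - \sum_i a_i(c)\,\alpha_i$. Adding or
  removing all $i$-nodes of a core changes this weight exactly as $s_i$ does, because for every
  partition the number of addable minus the number of removable $i$-nodes is
  $\langle \mathrm{wt}(c), \alpha_i^\vee\rangle$ (\<open>core_weight_coroot\<close>), and a core never has nodes of
  both kinds for the same residue. Hence $c = w\cdot\varnothing$ gives
  $\mathrm{wt}(c) = w\Lambda_0$, that is, $\Lambda_0 - w\Lambda_0 = \sum_i a_i(c)\,\alpha_i$ in terms of the
  simple roots of type $A_{2n-1}^{(1)}$. If $c$ is self-conjugate then $a_i(c) = a_{2n-i}(c)$, and the
  sum folds to
  $$a_0(c)\,\alpha_0 + \sum_{0<i<n} a_i(c)\,(\alpha_i + \alpha_{2n-i}) + \tfrac12 a_n(c)\cdot 2\alpha_n .$$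
  The coefficients add up to $a_0 + \dots + a_{n-1} + \tfrac12 a_n = \frac12(L(c) + a_0(c))$, the last
  equality again by symmetry. Linear independence of the simple roots (\<open>root_comb_eqD\<close>) makes the
  coefficients unique.

  The identifications used on the way have to be established as well.
  The weight determines the core (\<open>flush_eqI_weight\<close>), so the action of a group element on the empty
  partition depends only on the element and not on a word for it: $w\cdot\varnothing = c$ just says
  $\mathrm{wt}(c) = w\Lambda_0$ (\<open>core_action_empty_iff\<close>). A self-conjugate core loses boxes under
  some generator of the Weyl group of type $A_{2n}^{(2)}$ and stays self-conjugate, so by induction
  it is reached from the empty partition (\<open>self_conjugate_weight_reached\<close>); and since the finite Weyl
  group fixes $\Lambda_0$, the element that reaches it can be taken of minimal length in its coset
  (\<open>A2_grassmannian_representative\<close>).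

  All combinatorics of cores is done on bead sequences. The boundary of a diagram, read along the
  diagonals, is a lattice path. Its vertical steps are the beads: a removable node is a
  bead that can move down by one place, an addable node a bead that can move up, and in an
  $m$-core the beads on each runner of the $m$-abacus are pushed down without gaps.
\<close>

section \<open>Partitions and their boundary paths\<close>

lemma partition_down: "\<lbrakk>is_partition c; (i, j) \<in> c; i' \<le> i; j' \<le> j\<rbrakk> \<Longrightarrow> (i', j') \<in> c"
  unfolding is_partition_def by fast

lemma partition_finite: "is_partition c \<Longrightarrow> finite c"
  by (simp add: is_partition_def)

lemma is_partition_steps:
  "is_partition c \<longleftrightarrow>
     finite c \<and> (\<forall>i j. (Suc i, j) \<in> c \<longrightarrow> (i, j) \<in> c) \<and> (\<forall>i j. (i, Suc j) \<in> c \<longrightarrow> (i, j) \<in> c)"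
  (is "?L \<longleftrightarrow> ?R")
proof
  assume ?L
  then show ?R
    by (metis partition_finite partition_down le_SucI le_refl)
next
  assume R: ?R
  then have up: "\<And>i j. (Suc i, j) \<in> c \<Longrightarrow> (i, j) \<in> c" and left: "\<And>i j. (i, Suc j) \<in> c \<Longrightarrow> (i, j) \<in> c"
    by blast+
  have rows: "(i + d, j) \<in> c \<Longrightarrow> (i, j) \<in> c" for i j d
    by (induction d) (auto dest: up)
  have cols: "(i, j + d) \<in> c \<Longrightarrow> (i, j) \<in> c" for i j d
    by (induction d) (auto dest: left)
  have "(i', j') \<in> c" if "(i, j) \<in> c" "i' \<le> i" "j' \<le> j" for i j i' j'
    using rows[of i' "i - i'" j] cols[of i' j' "j - j'"] that by simp
  then have "\<forall>(i, j) \<in> c. \<forall>i' \<le> i. \<forall>j' \<le> j. (i', j') \<in> c" by blast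
  moreover have "finite c" using R by (rule conjunct1)
  ultimately show ?L by (simp add: is_partition_def)
qed

definition content :: "box \<Rightarrow> int" where
  "content = (\<lambda>(i, j). int j - int i)"

definition diag_count :: "box set \<Rightarrow> int \<Rightarrow> nat" where
  "diag_count c k = card {b \<in> c. content b = k}"

text \<open>The boundary of the diagram meets the diagonal of content \<open>k\<close> at row \<open>profile c k\<close>: the
  diagonal starts in row $\max(0,-k)$ and its boxes in \<open>c\<close> are an initial segment. In this
  form no case distinction on the sign of \<open>k\<close> is needed.\<close>

definition profile :: "box set \<Rightarrow> int \<Rightarrow> int" where
  "profile c k = int (diag_count c k) + max 0 (- k)"

text \<open>The boundary path takes a vertical step between the diagonals \<open>k\<close> and \<open>k + 1\<close>. The contents
  \<open>k\<close> with a bead are the numbers $\lambda_i - 1 - i$, one for each row $i$ (empty rows included),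
  that is, the beta set of the partition.\<close>

definition bead :: "box set \<Rightarrow> int \<Rightarrow> bool" where
  "bead c k \<longleftrightarrow> profile c (k + 1) < profile c k"

lemma content_simp [simp]: "content (i, j) = int j - int i"
  by (simp add: content_def)

lemma profile_nonneg: "0 \<le> profile c k" "0 \<le> profile c k + k"
  by (auto simp: profile_def)

lemma down_set_eq_lessThan_card:
  fixes T :: "nat set"
  assumes "finite T" and "\<And>t t'. t \<in> T \<Longrightarrow> t' \<le> t \<Longrightarrow> t' \<in> T"
  shows "T = {..<card T}"
proof (cases "T = {}")
  case False
  have "T = {..Max T}"
    using assms False by (auto intro: Max_in)
  then show ?thesis by (metis card_atMost lessThan_Suc_atMost)
qed simp

lemma mem_iff_profile:
  assumes "is_partition c"
  shows "(i, j) \<in> c \<longleftrightarrow> int i < profile c (int j - int i)"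
proof -
  define k where "k = int j - int i"
  \<comment> \<open>The boxes of content \<open>k\<close>, numbered from the edge of the quadrant.\<close>
  define p where "p t = (t + nat (- k), t + nat k)" for t :: nat
  define T where "T = {t. p t \<in> c}"
  have inj: "inj p" by (auto simp: p_def inj_on_def)
  have img: "p ` T = {b \<in> c. content b = k}"
  proof (intro equalityI subsetI)
    fix b assume "b \<in> {b \<in> c. content b = k}"
    moreover obtain x y where b: "b = (x, y)" by fastforce
    ultimately have "b = p (min x y)" by (auto simp: p_def)
    with \<open>b \<in> _\<close> show "b \<in> p ` T" by (auto simp: T_def)
  qed (auto simp: T_def p_def)
  have "finite (p ` T)" unfolding img using partition_finite[OF assms] by simp
  then have fin: "finite T" using inj by (metis finite_imageD inj_on_subset subset_UNIV)
  have "T = {..<card T}"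
    using fin by (rule down_set_eq_lessThan_card)
      (auto simp: T_def p_def intro: partition_down[OF assms])
  moreover have "card T = diag_count c k"
    unfolding diag_count_def img[symmetric] using inj by (metis card_image inj_on_subset subset_UNIV)
  ultimately have T: "t \<in> T \<longleftrightarrow> t < diag_count c k" for t by auto
  have "(i, j) = p (min i j)" by (auto simp: p_def k_def)
  then have "(i, j) \<in> c \<longleftrightarrow> min i j < diag_count c k" using T by (simp add: T_def)
  also have "\<dots> \<longleftrightarrow> int i < profile c k" by (auto simp: profile_def k_def)
  finally show ?thesis by (simp add: k_def)
qed

text \<open>From one diagonal to the next the path goes either one column to the right or one row
  up; anything else would contradict that \<open>c\<close> is closed towards the origin.\<close>

lemma profile_step:
  assumes c: "is_partition c"
  shows "profile c (k + 1) = profile c k - of_bool (bead c k)"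
proof -
  have "profile c (k + 1) \<le> profile c k"
  proof (rule ccontr)
    assume a: "\<not> ?thesis"
    define i where "i = nat (profile c k)"
    define j where "j = nat (profile c k + k)"
    have ij: "int i = profile c k" "int j = profile c k + k"
      using profile_nonneg[of c k] by (auto simp: i_def j_def)
    have "(i, Suc j) \<in> c" using a ij by (simp add: mem_iff_profile[OF c] add.commute)
    then have "(i, j) \<in> c" by (rule partition_down[OF c]) auto
    then show False using ij by (simp add: mem_iff_profile[OF c])
  qed
  moreover have "profile c k - 1 \<le> profile c (k + 1)"
  proof (rule ccontr)
    assume a: "\<not> ?thesis"
    define i where "i = nat (profile c (k + 1))"
    define j where "j = nat (profile c (k + 1) + k + 1)"
    have ij: "int i = profile c (k + 1)" "int j = profile c (k + 1) + k + 1"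
      using profile_nonneg[of c "k + 1"] by (auto simp: i_def j_def)
    have "(Suc i, j) \<in> c" using a ij by (simp add: mem_iff_profile[OF c])
    then have "(i, j) \<in> c" by (rule partition_down[OF c]) auto
    then show False using ij by (simp add: mem_iff_profile[OF c] add.commute)
  qed
  ultimately show ?thesis by (auto simp: bead_def)
qed

lemma profile_antimono:
  assumes "is_partition c" "k \<le> l"
  shows "profile c l \<le> profile c k"
  using assms(2)
proof (induction l rule: int_ge_induct)
  case (step l)
  then show ?case using profile_step[OF assms(1), of l] by simp
qed simp

text \<open>Beads pushed down on every runner of the \<open>m\<close>-abacus. This is the description of \<open>m\<close>-cores that
  the reflections preserve visibly.\<close>

definition flush :: "nat \<Rightarrow> box set \<Rightarrow> bool" where
  "flush m c \<longleftrightarrow> is_partition c \<and> (\<forall>k. bead c k \<longrightarrow> bead c (k - int m))"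

text \<open>A bead at \<open>k\<close> marks the right end of a row \<open>i\<close>, and a gap at \<open>k - m\<close> marks the lower end of a column
  \<open>j\<close>. The hook of the box \<open>(i, j)\<close> runs along the boundary between these two steps, so its length is \<open>m\<close>.\<close>

lemma cores_flush:
  assumes "c \<in> cores m"
  shows "flush m c"
proof -
  have c: "is_partition c" using assms by (simp add: cores_def)
  have "bead c (k - int m)" if b: "bead c k" for k
  proof (rule ccontr)
    assume nb: "\<not> bead c (k - int m)"
    define l where "l = k - int m"
    \<comment> \<open>Row \<open>i\<close> ends at the vertical step at \<open>k\<close>, column \<open>j\<close> at the horizontal step at \<open>l\<close>.\<close>
    define i where "i = nat (profile c (k + 1))"
    define j where "j = nat (profile c l + l)"
    have pk: "profile c (k + 1) = profile c k - 1" using profile_step[OF c, of k] b by simp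
    have pl: "profile c (l + 1) = profile c l" using profile_step[OF c, of l] nb by (simp add: l_def)
    have i: "int i = profile c (k + 1)" "int i = profile c k - 1"
      using profile_nonneg[of c "k + 1"] pk by (auto simp: i_def)
    have j: "int j = profile c l + l"
      using profile_nonneg[of c l] by (auto simp: j_def)
    have row: "(i, j') \<in> c \<longleftrightarrow> int j' < profile c k + k" for j'
    proof
      assume a: "(i, j') \<in> c"
      show "int j' < profile c k + k"
      proof (rule ccontr)
        assume n: "\<not> ?thesis"
        then have "k + 1 \<le> int j' - int i" using i by simp
        then have "profile c (int j' - int i) \<le> profile c (k + 1)"
          by (rule profile_antimono[OF c])
        then show False using a i by (simp add: mem_iff_profile[OF c])
      qed
    next
      assume "int j' < profile c k + k"
      then have "int j' - int i \<le> k" using i by simp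
      then have "profile c k \<le> profile c (int j' - int i)" by (rule profile_antimono[OF c])
      then show "(i, j') \<in> c" using i by (simp add: mem_iff_profile[OF c])
    qed
    have col: "(i', j) \<in> c \<longleftrightarrow> int i' < profile c l" for i'
    proof
      assume a: "(i', j) \<in> c"
      show "int i' < profile c l"
      proof (rule ccontr)
        assume n: "\<not> ?thesis"
        then have "(nat (profile c l), j) \<in> c"
          by (intro partition_down[OF c a]) auto
        then show False using j profile_nonneg[of c l] by (simp add: mem_iff_profile[OF c])
      qed
    next
      assume "int i' < profile c l"
      then have "l + 1 \<le> int j - int i'" "int j - int i' \<le> int j - int i'" using j by auto
      moreover have "(nat (profile c l - 1), j) \<in> c"
        using pl j \<open>int i' < profile c l\<close> by (simp add: mem_iff_profile[OF c] add.commute)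
      ultimately show "(i', j) \<in> c"
        using \<open>int i' < profile c l\<close> by (auto intro: partition_down[OF c])
    qed
    have "profile c k \<le> profile c l" by (rule profile_antimono[OF c]) (simp add: l_def)
    then have "int i < profile c l" using i by simp
    then have mem: "(i, j) \<in> c" by (simp add: col)
    have "{j'. j < j' \<and> (i, j') \<in> c} = {j<..<nat (profile c k + k)}"
      by (auto simp: row)
    moreover have "{i'. i < i' \<and> (i', j) \<in> c} = {i<..<nat (profile c l)}"
      by (auto simp: col)
    ultimately have "hook_length c (i, j) = m"
      using mem i j row[of j] col[of i] by (simp add: hook_length_def l_def)
    then show False using assms mem by (auto simp: cores_def)
  qed
  then show ?thesis using c by (simp add: flush_def)
qed

lemma bead_descend:
  assumes "flush m c" "bead c l" "k \<le> l" "k mod int m = l mod int m"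
  shows "bead c k"
proof -
  have "bead c (l - int t * int m)" for t
  proof (induction t)
    case (Suc t)
    then have "bead c (l - int t * int m - int m)" using assms(1) by (simp add: flush_def)
    then show ?case by (simp add: algebra_simps)
  qed (use assms in simp)
  moreover obtain q where q: "l - k = int m * q"
    using assms(4) by (metis dvdE mod_eq_dvd_iff)
  ultimately show ?thesis
  proof (cases "m = 0")
    case False
    then have "q \<ge> 0" using q assms(3) by (metis diff_ge_0_iff_ge of_nat_0_less_iff zero_le_mult_iff not_less neq0_conv)
    then show ?thesis using \<open>\<And>t. bead c (l - int t * int m)\<close>[of "nat q"] q
      by (simp add: algebra_simps)
  qed (use assms q in simp)
qed

text \<open>On each diagonal only the first box outside \<open>c\<close> can be addable. It is so when its upper and its
  left neighbour are in \<open>c\<close> (or do not exist), which says that the path has a corner there.\<close>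

lemma addable_iff:
  assumes c: "is_partition c"
  shows "(i, j) \<notin> c \<and> is_partition (insert (i, j) c) \<longleftrightarrow>
    int i = profile c (int j - int i) \<and> bead c (int j - int i - 1) \<and> \<not> bead c (int j - int i)"
proof -
  define k where "k = int j - int i"
  have s1: "profile c (k + 1) = profile c k - of_bool (bead c k)" by (rule profile_step[OF c])
  have s2: "profile c k = profile c (k - 1) - of_bool (bead c (k - 1))"
    using profile_step[OF c, of "k - 1"] by simp
  have n: "0 \<le> profile c (k + 1)" "0 \<le> profile c (k - 1) + k - 1"
    using profile_nonneg[of c "k + 1"] profile_nonneg[of c "k - 1"] by auto
  have mem: "(i, j) \<in> c \<longleftrightarrow> int i < profile c k"
    "i > 0 \<Longrightarrow> (i - 1, j) \<in> c \<longleftrightarrow> int i - 1 < profile c (k + 1)"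
    "j > 0 \<Longrightarrow> (i, j - 1) \<in> c \<longleftrightarrow> int i < profile c (k - 1)"
    by (auto simp: mem_iff_profile[OF c] k_def of_nat_diff algebra_simps)
  have steps: "(Suc x, y) \<in> c \<Longrightarrow> (x, y) \<in> c" "(x, Suc y) \<in> c \<Longrightarrow> (x, y) \<in> c" for x y
    by (erule partition_down[OF c]; simp)+
  have ins: "is_partition (insert (i, j) c) \<longleftrightarrow> (i > 0 \<longrightarrow> (i - 1, j) \<in> c) \<and> (j > 0 \<longrightarrow> (i, j - 1) \<in> c)"
    if "(i, j) \<notin> c"
  proof
    assume p: "is_partition (insert (i, j) c)"
    show "(i > 0 \<longrightarrow> (i - 1, j) \<in> c) \<and> (j > 0 \<longrightarrow> (i, j - 1) \<in> c)"
      using partition_down[OF p, of i j "i - 1" j] partition_down[OF p, of i j i "j - 1"] by auto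
  next
    assume "(i > 0 \<longrightarrow> (i - 1, j) \<in> c) \<and> (j > 0 \<longrightarrow> (i, j - 1) \<in> c)"
    then show "is_partition (insert (i, j) c)"
      using partition_finite[OF c] unfolding is_partition_steps by (auto dest: steps)
  qed
  have "(i, j) \<notin> c \<and> is_partition (insert (i, j) c) \<longleftrightarrow>
      profile c k \<le> int i \<and> (i > 0 \<longrightarrow> int i - 1 < profile c (k + 1)) \<and>
      (j > 0 \<longrightarrow> int i < profile c (k - 1))"
    using ins mem by (meson linorder_not_less)
  also have "\<dots> \<longleftrightarrow> int i = profile c k \<and> bead c (k - 1) \<and> \<not> bead c k"
  proof -
    have arith: "(p \<le> x \<and> (x > 0 \<longrightarrow> x - 1 < a) \<and> (x + l > 0 \<longrightarrow> x < b)) \<longleftrightarrow> x = p \<and> B \<and> \<not> A"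
      if "a = p - of_bool A" "p = b - of_bool B" "0 \<le> a" "0 \<le> b + l - 1" "0 \<le> p" "0 \<le> p + l"
      for p a b x l :: int and A B
      using that by (cases A; cases B) (simp_all, presburger+)
    have "int i + k > 0 \<longleftrightarrow> j > 0" by (simp add: k_def)
    with arith[OF s1 s2 n profile_nonneg[of c k], of "int i"] show ?thesis
      by (simp only: of_nat_0_less_iff)
  qed
  finally show ?thesis by (simp only: k_def)
qed

lemma removable_iff:
  assumes c: "is_partition c"
  shows "(i, j) \<in> c \<and> is_partition (c - {(i, j)}) \<longleftrightarrow>
    int i = profile c (int j - int i) - 1 \<and> bead c (int j - int i) \<and> \<not> bead c (int j - int i - 1)"
proof -
  define k where "k = int j - int i"
  have s1: "profile c (k + 1) = profile c k - of_bool (bead c k)" by (rule profile_step[OF c])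
  have s2: "profile c k = profile c (k - 1) - of_bool (bead c (k - 1))"
    using profile_step[OF c, of "k - 1"] by simp
  have mem: "(i, j) \<in> c \<longleftrightarrow> int i < profile c k"
    "(Suc i, j) \<in> c \<longleftrightarrow> int i + 1 < profile c (k - 1)"
    "(i, Suc j) \<in> c \<longleftrightarrow> int i < profile c (k + 1)"
    by (auto simp: mem_iff_profile[OF c] k_def algebra_simps)
  have steps: "(Suc x, y) \<in> c \<Longrightarrow> (x, y) \<in> c" "(x, Suc y) \<in> c \<Longrightarrow> (x, y) \<in> c" for x y
    by (erule partition_down[OF c]; simp)+
  have "is_partition (c - {(i, j)}) \<longleftrightarrow> (Suc i, j) \<notin> c \<and> (i, Suc j) \<notin> c"
  proof
    assume p: "is_partition (c - {(i, j)})"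
    show "(Suc i, j) \<notin> c \<and> (i, Suc j) \<notin> c"
      using partition_down[OF p, of "Suc i" j i j] partition_down[OF p, of i "Suc j" i j] by auto
  next
    assume "(Suc i, j) \<notin> c \<and> (i, Suc j) \<notin> c"
    then show "is_partition (c - {(i, j)})"
      using partition_finite[OF c] unfolding is_partition_steps by (auto dest: steps)
  qed
  then have "(i, j) \<in> c \<and> is_partition (c - {(i, j)}) \<longleftrightarrow>
      int i < profile c k \<and> \<not> int i + 1 < profile c (k - 1) \<and> \<not> int i < profile c (k + 1)"
    by (simp only: mem)
  also have "\<dots> \<longleftrightarrow> int i = profile c k - 1 \<and> bead c k \<and> \<not> bead c (k - 1)"
  proof -
    have "(x < p \<and> \<not> x + 1 < b \<and> \<not> x < a) \<longleftrightarrow> x = p - 1 \<and> A \<and> \<not> B"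
      if "a = p - of_bool A" "p = b - of_bool B" for p a b x :: int and A B
      using that by (cases A; cases B) auto
    from this[OF s1 s2] show ?thesis .
  qed
  finally show ?thesis by (simp only: k_def)
qed

text \<open>Outside a finite range of contents the bead sequence is that of the empty partition. Sums
  over all contents of one residue can therefore be taken over a finite window.\<close>

lemma content_window:
  assumes "finite c"
  obtains N where "N > 0" "content ` c \<subseteq> {- N<..<N}"
proof -
  let ?N = "1 + Max (insert 0 ((\<lambda>b. \<bar>content b\<bar>) ` c))"
  have fin: "finite (insert 0 ((\<lambda>b. \<bar>content b\<bar>) ` c))" using assms by simp
  have "\<bar>content b\<bar> < ?N" if "b \<in> c" for b
    using Max_ge[OF fin, of "\<bar>content b\<bar>"] that by simp
  then have "content ` c \<subseteq> {- ?N<..<?N}" by (force simp: abs_less_iff)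
  moreover have "?N > 0" using Max_ge[OF fin, of 0] by simp
  ultimately show thesis using that by blast
qed

lemma diag_count_outside:
  assumes "content ` c \<subseteq> I" "k \<notin> I"
  shows "diag_count c k = 0"
proof -
  have "{b \<in> c. content b = k} = {}" using assms by blast
  then show ?thesis by (simp only: diag_count_def card.empty)
qed

text \<open>The beads are the first differences of the diagonal lengths, up to the beads of the empty
  partition at the negative contents.\<close>

lemma of_bool_bead:
  assumes "is_partition c"
  shows "of_bool (bead c k) = int (diag_count c k) - int (diag_count c (k + 1)) + of_bool (k < 0)"
  using profile_step[OF assms, of k] by (auto simp: profile_def max_def split: if_splits)

lemma bead_outside:
  assumes c: "is_partition c" and N: "content ` c \<subseteq> {- N<..<N}" "N > 0" and k: "k \<notin> {- N..<N}"
  shows "bead c k \<longleftrightarrow> k < 0"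
proof -
  have "diag_count c k = 0" "diag_count c (k + 1) = 0"
    using k by (auto intro: diag_count_outside[OF N(1)])
  then show ?thesis using of_bool_bead[OF c, of k] by (cases "bead c k"; cases "k < 0") auto
qed

lemma bead_change_bounded:
  assumes c: "is_partition c" and N: "content ` c \<subseteq> {- N<..<N}" "N > 0"
    and change: "bead c k \<noteq> bead c (k - 1)"
  shows "k \<in> {- N..N}"
proof (rule ccontr)
  assume "\<not> ?thesis"
  then have "k \<notin> {- N..<N}" "k - 1 \<notin> {- N..<N}" "k \<noteq> 0" using N by auto
  then show False using change bead_outside[OF c N] by auto
qed

section \<open>Reflections of bead sequences\<close>

lemma residue_eq_iff:
  assumes "m > 0"
  shows "residue m b = nat (r mod int m) \<longleftrightarrow> content b mod int m = r mod int m"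
  using assms by (cases b) (simp add: residue_def content_def eq_nat_nat_iff)

lemma residue_iff:
  assumes "i < m"
  shows "residue m b = i \<longleftrightarrow> content b mod int m = int i"
  using residue_eq_iff[of m b "int i"] assms by simp

definition addable_contents :: "nat \<Rightarrow> nat \<Rightarrow> box set \<Rightarrow> int set" where
  "addable_contents m i c = {k. k mod int m = int i \<and> bead c (k - 1) \<and> \<not> bead c k}"

definition removable_contents :: "nat \<Rightarrow> nat \<Rightarrow> box set \<Rightarrow> int set" where
  "removable_contents m i c = {k. k mod int m = int i \<and> bead c k \<and> \<not> bead c (k - 1)}"

lemma addable_nodes_content:
  assumes c: "is_partition c" and i: "i < m"
  shows "bij_betw content (addable_nodes m i c) (addable_contents m i c)"
  unfolding bij_betw_def
proof
  have A: "(x, y) \<in> addable_nodes m i c \<longleftrightarrow>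
      int x = profile c (content (x, y)) \<and> content (x, y) \<in> addable_contents m i c" for x y
    using addable_iff[OF c, of x y] residue_iff[OF i, of "(x, y)"]
    by (auto simp: addable_nodes_def addable_contents_def)
  show "inj_on content (addable_nodes m i c)"
  proof (rule inj_onI)
    fix b b' assume *: "b \<in> addable_nodes m i c" "b' \<in> addable_nodes m i c" "content b = content b'"
    obtain x y x' y' where b: "b = (x, y)" "b' = (x', y')" by (metis surj_pair)
    have "int x = int x'" using * unfolding b A by metis
    then show "b = b'" using * by (simp add: b)
  qed
  show "content ` addable_nodes m i c = addable_contents m i c"
  proof (intro equalityI subsetI)
    fix k assume k: "k \<in> addable_contents m i c"
    define b where "b = (nat (profile c k), nat (profile c k + k))"
    have "content b = k" using profile_nonneg[of c k] by (simp add: b_def)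
    moreover have "b \<in> addable_nodes m i c"
      using k profile_nonneg[of c k] unfolding b_def A by simp
    ultimately show "k \<in> content ` addable_nodes m i c" by blast
  qed (use A in auto)
qed

lemma removable_nodes_content:
  assumes c: "is_partition c" and i: "i < m"
  shows "bij_betw content (removable_nodes m i c) (removable_contents m i c)"
  unfolding bij_betw_def
proof
  have R: "(x, y) \<in> removable_nodes m i c \<longleftrightarrow>
      int x = profile c (content (x, y)) - 1 \<and> content (x, y) \<in> removable_contents m i c" for x y
    using removable_iff[OF c, of x y] residue_iff[OF i, of "(x, y)"]
    by (auto simp: removable_nodes_def removable_contents_def)
  show "inj_on content (removable_nodes m i c)"
  proof (rule inj_onI)
    fix b b' assume *: "b \<in> removable_nodes m i c" "b' \<in> removable_nodes m i c" "content b = content b'"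
    obtain x y x' y' where b: "b = (x, y)" "b' = (x', y')" by (metis surj_pair)
    have "int x = int x'" using * unfolding b R by metis
    then show "b = b'" using * by (simp add: b)
  qed
  show "content ` removable_nodes m i c = removable_contents m i c"
  proof (intro equalityI subsetI)
    fix k assume k: "k \<in> removable_contents m i c"
    define b where "b = (nat (profile c k - 1), nat (profile c k - 1 + k))"
    have "profile c k = profile c (k + 1) + 1" "profile c k = profile c (k - 1)"
      using k profile_step[OF c, of k] profile_step[OF c, of "k - 1"]
      by (auto simp: removable_contents_def)
    then have nonneg: "0 \<le> profile c k - 1" "0 \<le> profile c k - 1 + k"
      using profile_nonneg[of c "k + 1"] profile_nonneg[of c "k - 1"] by auto
    then have "content b = k" by (simp add: b_def)
    moreover have "b \<in> removable_nodes m i c"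
      using k nonneg unfolding b_def R by simp
    ultimately show "k \<in> content ` removable_nodes m i c" by blast
  qed (use R in auto)
qed

lemma card_fibre_inj:
  assumes "inj_on f A"
  shows "card {b \<in> A. f b = k} = of_bool (k \<in> f ` A)"
proof (cases "k \<in> f ` A")
  case True
  then obtain a where "a \<in> A" "f a = k" by blast
  then have "{b \<in> A. f b = k} = {a}" using assms by (auto dest: inj_onD)
  then show ?thesis using True by simp
next
  case False
  then have "{b \<in> A. f b = k} = {}" by blast
  then have "card {b \<in> A. f b = k} = 0" by (simp only: card.empty)
  then show ?thesis using False by simp
qed

lemma finite_addable_contents:
  assumes c: "is_partition c"
  shows "finite (addable_contents m i c)"
proof -
  obtain N where N: "N > 0" "content ` c \<subseteq> {- N<..<N}"
    by (rule content_window[OF partition_finite[OF c]])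
  have "addable_contents m i c \<subseteq> {- N..N}"
    using bead_change_bounded[OF c N(2,1)] by (auto simp: addable_contents_def simp del: atLeastAtMost_iff)
  then show ?thesis by (rule finite_subset) simp
qed

lemma finite_addable_nodes:
  assumes "is_partition c" "i < m"
  shows "finite (addable_nodes m i c)"
  using bij_betw_finite[OF addable_nodes_content[OF assms]]
    finite_addable_contents[OF assms(1)] by blast

lemma profile_add_nodes:
  assumes c: "is_partition c" and i: "i < m"
  shows "profile (c \<union> addable_nodes m i c) k = profile c k + of_bool (k \<in> addable_contents m i c)"
proof -
  let ?A = "addable_nodes m i c"
  have "{b \<in> c \<union> ?A. content b = k} = {b \<in> c. content b = k} \<union> {b \<in> ?A. content b = k}" by blast
  moreover have "{b \<in> c. content b = k} \<inter> {b \<in> ?A. content b = k} = {}"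
    by (auto simp: addable_nodes_def)
  ultimately have "diag_count (c \<union> ?A) k = diag_count c k + card {b \<in> ?A. content b = k}"
    using partition_finite[OF c] finite_addable_nodes[OF c i]
    by (simp add: diag_count_def card_Un_disjoint)
  then show ?thesis
    using addable_nodes_content[OF c i] by (simp add: profile_def card_fibre_inj bij_betw_def)
qed

lemma profile_remove_nodes:
  assumes c: "is_partition c" and i: "i < m"
  shows "profile (c - removable_nodes m i c) k = profile c k - of_bool (k \<in> removable_contents m i c)"
proof -
  let ?R = "removable_nodes m i c"
  have "{b \<in> c. content b = k} = {b \<in> c - ?R. content b = k} \<union> {b \<in> ?R. content b = k}"
    by (auto simp: removable_nodes_def)
  moreover have "{b \<in> c - ?R. content b = k} \<inter> {b \<in> ?R. content b = k} = {}" by blast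
  moreover have "finite ?R" using partition_finite[OF c] by (simp add: removable_nodes_def)
  ultimately have "diag_count c k = diag_count (c - ?R) k + card {b \<in> ?R. content b = k}"
    using partition_finite[OF c] by (simp add: diag_count_def card_Un_disjoint)
  then show ?thesis
    using removable_nodes_content[OF c i] by (simp add: profile_def card_fibre_inj bij_betw_def)
qed

lemma partition_add_nodes:
  assumes c: "is_partition c" and i: "i < m"
  shows "is_partition (c \<union> addable_nodes m i c)"
  unfolding is_partition_steps
proof (intro conjI allI impI)
  show "finite (c \<union> addable_nodes m i c)"
    using partition_finite[OF c] finite_addable_nodes[OF c i] by simp
  have *: "b' \<in> c" if "b \<in> c \<union> addable_nodes m i c" "fst b' \<le> fst b" "snd b' \<le> snd b" "b' \<noteq> b" for b b'
  proof (cases "b \<in> c")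
    case True
    then show ?thesis using that partition_down[OF c, of "fst b" "snd b" "fst b'" "snd b'"] by simp
  next
    case False
    then have "is_partition (insert b c)" using that by (simp add: addable_nodes_def)
    then show ?thesis using that partition_down[of "insert b c" "fst b" "snd b" "fst b'" "snd b'"] by simp
  qed
  fix x y
  show "(x, y) \<in> c \<union> addable_nodes m i c" if "(Suc x, y) \<in> c \<union> addable_nodes m i c"
    using *[OF that, of "(x, y)"] by simp
  show "(x, y) \<in> c \<union> addable_nodes m i c" if "(x, Suc y) \<in> c \<union> addable_nodes m i c"
    using *[OF that, of "(x, y)"] by simp
qed

lemma partition_remove_nodes:
  assumes c: "is_partition c"
  shows "is_partition (c - removable_nodes m i c)"
  unfolding is_partition_steps
proof (intro conjI allI impI)
  show "finite (c - removable_nodes m i c)" using partition_finite[OF c] by simp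
  have *: "b' \<in> c - removable_nodes m i c"
    if "b \<in> c" "fst b' \<le> fst b" "snd b' \<le> snd b" "b' \<noteq> b" for b b'
  proof -
    have "b' \<in> c" using that partition_down[OF c, of "fst b" "snd b" "fst b'" "snd b'"] by simp
    moreover have "\<not> is_partition (c - {b'})"
      using that partition_down[of "c - {b'}" "fst b" "snd b" "fst b'" "snd b'"] by auto
    ultimately show ?thesis by (simp add: removable_nodes_def)
  qed
  fix x y
  show "(x, y) \<in> c - removable_nodes m i c" if "(Suc x, y) \<in> c - removable_nodes m i c"
    using *[of "(Suc x, y)" "(x, y)"] that by simp
  show "(x, y) \<in> c - removable_nodes m i c" if "(x, Suc y) \<in> c - removable_nodes m i c"
    using *[of "(x, Suc y)" "(x, y)"] that by simp
qed

text \<open>Consider an addable node and a removable node of the same residue. The bead of the one at the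
  larger content forces, going down its runner, a bead where the other node needs a gap.\<close>

lemma flush_addable_or_removable:
  assumes "flush m c"
  shows "addable_contents m i c = {} \<or> removable_contents m i c = {}"
proof (rule ccontr)
  assume "\<not> ?thesis"
  then obtain k l where k: "bead c (k - 1)" "\<not> bead c k" "k mod int m = int i"
    and l: "bead c l" "\<not> bead c (l - 1)" "l mod int m = int i"
    by (auto simp: addable_contents_def removable_contents_def)
  show False
  proof (cases "k \<le> l")
    case True
    then show False using bead_descend[OF assms l(1)] k l by auto
  next
    case False
    have "(l - 1) mod int m = (k - 1) mod int m" using k l by (metis mod_diff_cong)
    then show False using bead_descend[OF assms k(1), of "l - 1"] False l by auto
  qed
qed

lemma nodes_empty_iff:
  assumes "is_partition c" "i < m"
  shows "addable_nodes m i c = {} \<longleftrightarrow> addable_contents m i c = {}"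
    and "removable_nodes m i c = {} \<longleftrightarrow> removable_contents m i c = {}"
  using addable_nodes_content[OF assms] removable_nodes_content[OF assms]
  by (auto simp: bij_betw_def)

lemma flush_partition: "flush m c \<Longrightarrow> is_partition c"
  by (simp add: flush_def)

text \<open>Since one of the two sets is empty, the three cases in the definition of the reflection are covered by a
  single formula.\<close>

lemma core_reflection_profile:
  assumes c: "flush m c" and i: "i < m"
  shows "is_partition (core_reflection m i c)"
    and "profile (core_reflection m i c) k =
      profile c k + of_bool (k \<in> addable_contents m i c) - of_bool (k \<in> removable_contents m i c)"
proof -
  note p = flush_partition[OF c]
  show "is_partition (core_reflection m i c)"
    using p partition_add_nodes[OF p i] partition_remove_nodes[OF p]
    by (simp add: core_reflection_def)
  show "profile (core_reflection m i c) k =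
      profile c k + of_bool (k \<in> addable_contents m i c) - of_bool (k \<in> removable_contents m i c)"
    using flush_addable_or_removable[OF c, of i] profile_add_nodes[OF p i, of k]
      profile_remove_nodes[OF p i, of k] nodes_empty_iff[OF p i]
    by (auto simp: core_reflection_def)
qed

text \<open>The affine permutation of contents that exchanges \<open>k - 1\<close> and \<open>k\<close> for all \<open>k\<close> congruent to \<open>i\<close>
  modulo \<open>m\<close>.\<close>

definition bead_swap :: "nat \<Rightarrow> nat \<Rightarrow> int \<Rightarrow> int" where
  "bead_swap m i k =
     (if k mod int m = int i then k - 1 else if (k + 1) mod int m = int i then k + 1 else k)"

text \<open>The reflection $s_i$ exchanges neighbouring runners of the abacus: as far as the two runners
  differ, the beads can move from one to the other in one direction only, and all of them do.\<close>

lemma core_reflection_bead: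
  assumes c: "flush m c" and i: "i < m" and m: "m \<ge> 2"
  shows "bead (core_reflection m i c) k = bead c (bead_swap m i k)"
proof -
  let ?d = "core_reflection m i c"
  note p = flush_partition[OF c]
  \<comment> \<open>For \<open>m = 1\<close> every content would belong to both runners.\<close>
  have excl: "\<not> (k mod int m = int i \<and> (k + 1) mod int m = int i)"
  proof
    assume "k mod int m = int i \<and> (k + 1) mod int m = int i"
    then have "int m dvd (k + 1) - k" by (metis mod_eq_dvd_iff)
    then show False using m by simp
  qed
  have nb: "\<not> (k \<in> addable_contents m i c \<and> l \<in> removable_contents m i c)" for k l
    using flush_addable_or_removable[OF c, of i] by blast
  have key: "of_bool (bead ?d k) = profile ?d k - profile ?d (k + 1)"
    using profile_step[OF core_reflection_profile(1)[OF c i], of k] by simp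
  also have "\<dots> = of_bool (bead c k)
      + of_bool (k \<in> addable_contents m i c) - of_bool (k \<in> removable_contents m i c)
      - of_bool (k + 1 \<in> addable_contents m i c) + of_bool (k + 1 \<in> removable_contents m i c)"
    using profile_step[OF p, of k] by (simp add: core_reflection_profile(2)[OF c i])
  finally have eq: "of_bool (bead ?d k) = (of_bool (bead c k)
      + of_bool (k \<in> addable_contents m i c) - of_bool (k \<in> removable_contents m i c)
      - of_bool (k + 1 \<in> addable_contents m i c) + of_bool (k + 1 \<in> removable_contents m i c) :: int)" .
  consider "k mod int m = int i" "(k + 1) mod int m \<noteq> int i"
    | "k mod int m \<noteq> int i" "(k + 1) mod int m = int i"
    | "k mod int m \<noteq> int i" "(k + 1) mod int m \<noteq> int i" using excl by blast
  then show ?thesis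
  proof cases
    case 1
    then show ?thesis using eq nb[of k k]
      by (cases "bead c k"; cases "bead c (k - 1)")
        (auto simp: addable_contents_def removable_contents_def bead_swap_def)
  next
    case 2
    then show ?thesis using eq nb[of "k + 1" "k + 1"]
      by (cases "bead c k"; cases "bead c (k + 1)")
        (auto simp: addable_contents_def removable_contents_def bead_swap_def)
  next
    case 3
    then show ?thesis using eq
      by (auto simp: addable_contents_def removable_contents_def bead_swap_def)
  qed
qed

text \<open>The swap commutes with the translation by \<open>m\<close>, so gapless runners stay gapless.\<close>

lemma core_reflection_flush:
  assumes c: "flush m c" and i: "i < m" and m: "m \<ge> 2"
  shows "flush m (core_reflection m i c)"
proof -
  have "bead_swap m i (k - int m) = bead_swap m i k - int m" for k
  proof -
    have "(k - int m) mod int m = k mod int m" "(k - int m + 1) mod int m = (k + 1) mod int m"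
      using minus_mod_self2[of k "int m"] minus_mod_self2[of "k + 1" "int m"]
      by (simp_all add: algebra_simps)
    then show ?thesis by (simp add: bead_swap_def)
  qed
  then show ?thesis
    using c core_reflection_profile(1)[OF c i]
    by (simp add: flush_def core_reflection_bead[OF assms])
qed

lemma flush_empty: "flush m {}"
  by (simp add: flush_def is_partition_def bead_def profile_def diag_count_def max_def)

section \<open>Numbers of nodes by residue\<close>

text \<open>Residue counts indexed by arbitrary integers, so that neighbouring residues can be written
  \<open>i - 1\<close> and \<open>i + 1\<close> without wrapping around.\<close>

definition cyc_count :: "nat \<Rightarrow> box set \<Rightarrow> int \<Rightarrow> int" where
  "cyc_count m c r = int (res_count m (nat (r mod int m)) c)"

lemma cyc_count_sum:
  assumes "finite c" "m > 0" "finite I" "content ` c \<subseteq> I"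
  shows "cyc_count m c r = (\<Sum>k | k \<in> I \<and> k mod int m = r mod int m. int (diag_count c k))"
proof -
  let ?J = "{k. k \<in> I \<and> k mod int m = r mod int m}"
  have "{b \<in> c. residue m b = nat (r mod int m)} = (\<Union>k\<in>?J. {b \<in> c. content b = k})"
    using assms(4) by (auto simp: residue_eq_iff[OF assms(2)])
  then have "res_count m (nat (r mod int m)) c = card (\<Union>k\<in>?J. {b \<in> c. content b = k})"
    by (simp add: res_count_def)
  also have "\<dots> = (\<Sum>k\<in>?J. card {b \<in> c. content b = k})"
    by (rule card_UN_disjoint) (use assms in auto)
  finally show ?thesis by (simp add: cyc_count_def diag_count_def)
qed

lemma cyc_count_shift:
  assumes "finite c" "m > 0" "content ` c \<subseteq> {- N<..<N}" "\<bar>s\<bar> \<le> 1"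
  shows "cyc_count m c (r + s) =
    (\<Sum>k | k \<in> {- N..N} \<and> k mod int m = r mod int m. int (diag_count c (k + s)))"
proof -
  have iff: "k mod int m = r mod int m \<longleftrightarrow> (k + s) mod int m = (r + s) mod int m" for k
    by (simp add: mod_eq_dvd_iff)
  have "{k. k \<in> {- N + s..N + s} \<and> k mod int m = (r + s) mod int m} =
      (\<lambda>k. k + s) ` {k. k \<in> {- N..N} \<and> k mod int m = r mod int m}"
    (is "?L = ?R")
  proof (intro equalityI subsetI)
    fix k assume "k \<in> ?L"
    then show "k \<in> ?R" by (intro image_eqI[of _ _ "k - s"]) (auto simp: iff)
  qed (auto simp: iff)
  moreover have "content ` c \<subseteq> {- N + s..N + s}" using assms(3,4) by force
  ultimately have "cyc_count m c (r + s) =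
      (\<Sum>k \<in> (\<lambda>k. k + s) ` {k. k \<in> {- N..N} \<and> k mod int m = r mod int m}. int (diag_count c k))"
    using cyc_count_sum[OF assms(1,2), of "{- N + s..N + s}" "r + s"] by simp
  also have "\<dots> = (\<Sum>k | k \<in> {- N..N} \<and> k mod int m = r mod int m. int (diag_count c (k + s)))"
    by (subst sum.reindex) (auto simp: inj_on_def)
  finally show ?thesis .
qed

lemma card_filter_sum: "finite J \<Longrightarrow> int (card {k \<in> J. P k}) = (\<Sum>k\<in>J. of_bool (P k))"
  by (simp add: Int_def)

text \<open>On each diagonal, addable minus removable nodes is the change of the bead sequence, so a second
  difference of diagonal lengths with a correction at content \<open>0\<close>. Summing over all contents of
  residue \<open>i\<close> turns the diagonal lengths into residue counts.\<close>

lemma card_addable_minus_removable: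
  assumes c: "is_partition c" and i: "i < m"
  shows "int (card (addable_nodes m i c)) - int (card (removable_nodes m i c)) =
    of_bool (i = 0) + cyc_count m c (int i - 1) - 2 * cyc_count m c (int i) + cyc_count m c (int i + 1)"
proof -
  have fin: "finite c" and m: "m > 0" using partition_finite[OF c] i by auto
  obtain N where N: "N > 0" "content ` c \<subseteq> {- N<..<N}" by (rule content_window[OF fin])
  define J where "J = {k. k \<in> {- N..N} \<and> k mod int m = int i mod int m}"
  have finJ: "finite J" by (rule finite_subset[of _ "{- N..N}"]) (auto simp: J_def)
  have range: "k \<in> {- N..N}" if "bead c k \<noteq> bead c (k - 1)" for k
    using bead_change_bounded[OF c N(2,1) that] .
  have A: "addable_contents m i c = {k \<in> J. bead c (k - 1) \<and> \<not> bead c k}"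
    using i range by (auto simp: addable_contents_def J_def)
  have R: "removable_contents m i c = {k \<in> J. bead c k \<and> \<not> bead c (k - 1)}"
    using i range by (auto simp: removable_contents_def J_def)
  have "int (card (addable_nodes m i c)) - int (card (removable_nodes m i c)) =
      int (card (addable_contents m i c)) - int (card (removable_contents m i c))"
    using addable_nodes_content[OF c i] removable_nodes_content[OF c i]
    by (simp add: bij_betw_same_card)
  also have "\<dots> = (\<Sum>k\<in>J. of_bool (bead c (k - 1) \<and> \<not> bead c k) - of_bool (bead c k \<and> \<not> bead c (k - 1)))"
    unfolding A R by (simp only: card_filter_sum[OF finJ] sum_subtractf)
  also have "\<dots> = (\<Sum>k\<in>J. of_bool (k = 0) + int (diag_count c (k + -1))
      - 2 * int (diag_count c (k + 0)) + int (diag_count c (k + 1)))"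
  proof (rule sum.cong[OF refl])
    fix k
    have "of_bool (bead c (k - 1) \<and> \<not> bead c k) - of_bool (bead c k \<and> \<not> bead c (k - 1)) =
        (of_bool (bead c (k - 1)) - of_bool (bead c k) :: int)" by simp
    also have "\<dots> = of_bool (k = 0) + int (diag_count c (k + -1))
      - 2 * int (diag_count c (k + 0)) + int (diag_count c (k + 1))"
      using of_bool_bead[OF c, of k] of_bool_bead[OF c, of "k - 1"] by simp
    finally show "of_bool (bead c (k - 1) \<and> \<not> bead c k) - of_bool (bead c k \<and> \<not> bead c (k - 1)) =
      of_bool (k = 0) + int (diag_count c (k + -1))
      - 2 * int (diag_count c (k + 0)) + int (diag_count c (k + 1))" .
  qed
  also have "\<dots> = (\<Sum>k\<in>J. of_bool (k = 0)) + (\<Sum>k\<in>J. int (diag_count c (k + -1)))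
      - 2 * (\<Sum>k\<in>J. int (diag_count c (k + 0))) + (\<Sum>k\<in>J. int (diag_count c (k + 1)))"
    by (simp only: sum.distrib sum_subtractf sum_distrib_left)
  also have "(\<Sum>k\<in>J. of_bool (k = 0)) = (of_bool (i = 0) :: int)"
  proof -
    have "{k \<in> J. k = 0} = (if i = 0 then {0} else {})" using N i by (auto simp: J_def)
    then show ?thesis by (simp add: card_filter_sum[OF finJ, symmetric])
  qed
  finally show ?thesis
    unfolding J_def using cyc_count_shift[OF fin m N(2), of "-1" "int i"]
      cyc_count_shift[OF fin m N(2), of 0 "int i"] cyc_count_shift[OF fin m N(2), of 1 "int i"]
    by simp
qed

text \<open>Gapless runners are determined by how far they reach, hence are linearly ordered by inclusion.\<close>

lemma flush_runners_nested:
  assumes "flush m c" "flush m d"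
  shows "(\<forall>k. k mod int m = r \<longrightarrow> bead c k \<longrightarrow> bead d k) \<or> (\<forall>k. k mod int m = r \<longrightarrow> bead d k \<longrightarrow> bead c k)"
proof (rule ccontr)
  assume "\<not> ?thesis"
  then obtain k l where "k mod int m = r" "bead c k" "\<not> bead d k" "l mod int m = r" "bead d l" "\<not> bead c l"
    by blast
  then show False using bead_descend[OF assms(1), of k l] bead_descend[OF assms(2), of l k]
    by (cases "k \<le> l") auto
qed

lemma partition_eqI_bead:
  assumes c: "is_partition c" and d: "is_partition d" and eq: "\<And>k. bead c k = bead d k"
  shows "c = d"
proof -
  obtain N where N: "content ` (c \<union> d) \<subseteq> {- N<..<N}" "N > 0"
    using content_window[of "c \<union> d"] partition_finite[OF c] partition_finite[OF d]
    by (metis finite_UnI)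
  have "profile c k = profile d k" for k
  proof (cases "k \<le> N")
    case True
    then show ?thesis
    proof (induction k rule: int_le_induct)
      case base
      have "diag_count c N = 0" "diag_count d N = 0"
        using N by (auto intro!: diag_count_outside[where I = "{- N<..<N}"])
      then show ?case by (simp add: profile_def)
    next
      case (step k)
      then show ?case using profile_step[OF c, of "k - 1"] profile_step[OF d, of "k - 1"] eq[of "k - 1"]
        by simp
    qed
  next
    case False
    then have "diag_count c k = 0" "diag_count d k = 0"
      using N by (auto intro!: diag_count_outside[where I = "{- N<..<N}"])
    then show ?thesis by (simp add: profile_def)
  qed
  then show ?thesis using mem_iff_profile[OF c] mem_iff_profile[OF d] by auto
qed

text \<open>The number of beads on the runner of residue \<open>r\<close>, relative to the empty partition, is the difference of
  the residue counts at \<open>r\<close> and \<open>r + 1\<close>. Two nested runners with equally many beads in the window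
  coincide, and the beads determine the partition.\<close>

lemma flush_eqI_res_count:
  assumes c: "flush m c" and d: "flush m d" and m: "m > 0"
    and eq: "\<And>i. i < m \<Longrightarrow> res_count m i c = res_count m i d"
  shows "c = d"
proof (rule partition_eqI_bead)
  show pc: "is_partition c" and pd: "is_partition d" using c d by (auto simp: flush_def)
  have fin: "finite c" "finite d" using pc pd by (auto simp: partition_finite)
  obtain N where N: "content ` (c \<union> d) \<subseteq> {- N<..<N}" "N > 0"
    using content_window[of "c \<union> d"] fin by (metis finite_UnI)
  then have Nc: "content ` c \<subseteq> {- N<..<N}" and Nd: "content ` d \<subseteq> {- N<..<N}" by auto
  have cyc: "cyc_count m c r = cyc_count m d r" for r
    using eq[of "nat (r mod int m)"] m by (simp add: cyc_count_def nat_less_iff)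
  fix k0
  define r where "r = k0 mod int m"
  define J where "J = {k. k \<in> {- N..N} \<and> k mod int m = k0 mod int m}"
  have finJ: "finite J" by (rule finite_subset[of _ "{- N..N}"]) (auto simp: J_def)
  have beads: "(\<Sum>k\<in>J. of_bool (bead e k)) =
      cyc_count m e k0 - cyc_count m e (k0 + 1) + (\<Sum>k\<in>J. of_bool (k < 0))"
    if "is_partition e" "content ` e \<subseteq> {- N<..<N}" for e
    using cyc_count_shift[OF partition_finite[OF that(1)] m that(2), of 0 k0]
      cyc_count_shift[OF partition_finite[OF that(1)] m that(2), of 1 k0]
    by (simp add: of_bool_bead[OF that(1)] J_def sum.distrib sum_subtractf del: sum_of_bool_eq)
  have sums: "(\<Sum>k\<in>J. of_bool (bead c k)) = (\<Sum>k\<in>J. of_bool (bead d k) :: int)"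
    using beads[OF pc Nc] beads[OF pd Nd] cyc by simp
  have same: "bead a k0 = bead b k0"
    if nest: "\<forall>k. k mod int m = r \<longrightarrow> bead a k \<longrightarrow> bead b k"
      and s: "(\<Sum>k\<in>J. of_bool (bead a k)) = (\<Sum>k\<in>J. of_bool (bead b k) :: int)"
      and ka: "k0 \<in> J" for a b
  proof -
    have "(\<Sum>k\<in>J. of_bool (bead b k) - of_bool (bead a k) :: int) = 0"
      using s by (simp only: sum_subtractf)
    moreover have "0 \<le> (of_bool (bead b k) - of_bool (bead a k) :: int)" if "k \<in> J" for k
      using nest that by (auto simp: J_def r_def)
    ultimately have "(of_bool (bead b k0) - of_bool (bead a k0) :: int) = 0"
      using finJ ka by (simp only: sum_nonneg_eq_0_iff)
    then show ?thesis by (cases "bead a k0"; cases "bead b k0") auto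
  qed
  show "bead c k0 = bead d k0"
  proof (cases "k0 \<in> J")
    case True
    show ?thesis using flush_runners_nested[OF c d, of r] same[OF _ sums True] same[OF _ sums[symmetric] True]
      by blast
  next
    case False
    then have "k0 \<notin> {- N..<N}" by (auto simp: J_def)
    then show ?thesis using bead_outside[OF pc Nc N(2)] bead_outside[OF pd Nd N(2)] by simp
  qed
qed

section \<open>Weights of cores\<close>

definition root_comb :: "nat \<Rightarrow> (nat \<Rightarrow> real) \<Rightarrow> weight" where
  "root_comb m a = (\<Sum>j<m. a j *\<^sub>w simple_root m j)"

lemma sum_scale_apply: "(\<Sum>j\<in>A. a j *\<^sub>w f j) k = (\<Sum>j\<in>A. a j * f j k)"
  by (induction A rule: infinite_finite_induct) (auto simp: scale_def zero_fun_def)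

lemma cartan_eq:
  assumes "m \<ge> 3" "k < m" "j < m"
  shows "cartan m k j = 2 * of_bool (j = k) - of_bool (j = (k + 1) mod m) - of_bool (j = (k + m - 1) mod m)"
proof -
  have s: "(k + 1) mod m = (if k + 1 = m then 0 else k + 1)" "(j + 1) mod m = (if j + 1 = m then 0 else j + 1)"
    using assms by (auto simp: mod_Suc)
  have p: "(k + m - 1) mod m = (if k = 0 then m - 1 else k - 1)"
  proof (cases "k = 0")
    case False
    then have "k + m - 1 = (k - 1) + m" by simp
    then show ?thesis using assms False by (simp only: mod_add_self2) simp
  qed (use assms in auto)
  show ?thesis unfolding cartan_def s p using assms by (auto split: if_splits)
qed

lemma root_comb_coroot:
  assumes "m \<ge> 3" "k < m"
  shows "root_comb m a k = 2 * a k - a ((k + 1) mod m) - a ((k + m - 1) mod m)"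
proof -
  have pick: "(\<Sum>j<m. a j * of_bool (j = l)) = a l" if "l < m" for l
  proof -
    have "(\<Sum>j<m. a j * of_bool (j = l)) = (\<Sum>j<m. if j = l then a j else 0)"
      by (rule sum.cong) auto
    then show ?thesis using that by simp
  qed
  have "root_comb m a k = (\<Sum>j<m. a j * cartan m k j)"
    using assms by (simp add: root_comb_def sum_scale_apply simple_root_def)
  also have "\<dots> = (\<Sum>j<m. 2 * (a j * of_bool (j = k)) - a j * of_bool (j = (k + 1) mod m)
      - a j * of_bool (j = (k + m - 1) mod m))"
    by (rule sum.cong) (simp_all only: lessThan_iff cartan_eq[OF assms] algebra_simps)
  also have "\<dots> = 2 * a k - a ((k + 1) mod m) - a ((k + m - 1) mod m)"
    unfolding sum_subtractf sum_distrib_left[symmetric]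
    using assms by (simp add: pick)
  finally show ?thesis .
qed

lemma root_comb_delta:
  assumes "m > 0"
  shows "root_comb m a m = a 0"
proof -
  have "root_comb m a m = (\<Sum>j<m. if j = 0 then a j else 0)"
    unfolding root_comb_def sum_scale_apply by (rule sum.cong) (auto simp: simple_root_def)
  then show ?thesis using assms by simp
qed

text \<open>A relation between the simple roots has coefficients \<open>x\<close> that are harmonic on the
  cycle of length \<open>m\<close>, since all pairings with simple coroots vanish, so they are all equal. The coordinate of
  $\delta$ gives \<open>x 0 = 0\<close>.\<close>

lemma root_comb_eqD:
  assumes m: "m \<ge> 3" and eq: "root_comb m a = root_comb m b" and j: "j < m"
  shows "a j = b j"
proof -
  define x where "x k = a k - b k" for k
  have x0: "x 0 = 0"
    using root_comb_delta[of m a] root_comb_delta[of m b] m eq by (simp add: x_def)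
  have rec: "2 * x k = x ((k + 1) mod m) + x ((k + m - 1) mod m)" if "k < m" for k
    using root_comb_coroot[OF m that, of a] root_comb_coroot[OF m that, of b] eq by (simp add: x_def)
  \<comment> \<open>Started at \<open>x 0 = 0\<close>, the recursion makes \<open>x\<close> linear; closing the cycle then forces slope \<open>0\<close>.\<close>
  have lin: "x k = real k * x 1 \<and> x (k + 1) = real (k + 1) * x 1" if "k + 1 < m" for k
    using that
  proof (induction k)
    case (Suc k)
    have "(Suc k + m - 1) mod m = k" using Suc.prems by (simp add: mod_if)
    then have "2 * x (Suc k) = x (Suc k + 1) + x k" using rec[of "Suc k"] Suc.prems by simp
    then show ?case using Suc by (simp add: algebra_simps)
  qed (simp add: x0)
  have "(m - 1 + m - 1) mod m = m - 2" using m by (simp add: mod_if)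
  then have "2 * x (m - 1) = x (m - 2)" using rec[of "m - 1"] m x0 by simp
  moreover have "x (m - 2) = real (m - 2) * x 1" "x (m - 1) = real (m - 1) * x 1"
    using lin[of "m - 2"] m by (simp_all add: numeral_2_eq_2 Suc_diff_Suc)
  ultimately have "(2 * real (m - 1) - real (m - 2)) * x 1 = 0" by (simp add: algebra_simps)
  moreover have "2 * real (m - 1) - real (m - 2) = real m" using m by (simp add: of_nat_diff)
  ultimately have "x 1 = 0" using m by simp
  then have "x j = 0"
    using lin[of j] lin[of "j - 1"] j m by (cases "j + 1 < m") auto
  then show ?thesis by (simp add: x_def)
qed

definition core_weight :: "nat \<Rightarrow> box set \<Rightarrow> weight" where
  "core_weight m c = fund_weight 0 - root_comb m (\<lambda>j. real (res_count m j c))"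

lemma core_weight_coroot:
  assumes c: "is_partition c" and m: "m \<ge> 3" and i: "i < m"
  shows "core_weight m c i = real (card (addable_nodes m i c)) - real (card (removable_nodes m i c))"
proof -
  have s: "nat ((int i + 1) mod int m) = (i + 1) mod m" "nat ((int i - 1) mod int m) = (i + m - 1) mod m"
    "nat (int i mod int m) = i"
  proof -
    have "(int i + 1) mod int m = int ((i + 1) mod m)" by (simp add: zmod_int add.commute)
    then show "nat ((int i + 1) mod int m) = (i + 1) mod m" by (simp only: nat_int)
    have "int (i + m - 1) = int i - 1 + int m" using m by simp
    then have "(int i - 1) mod int m = int ((i + m - 1) mod m)"
      by (simp only: zmod_int mod_add_self2)
    then show "nat ((int i - 1) mod int m) = (i + m - 1) mod m" by (simp only: nat_int)
  qed (use i in simp)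
  have "core_weight m c i = of_bool (i = 0) - (2 * real (res_count m i c)
      - real (res_count m ((i + 1) mod m) c) - real (res_count m ((i + m - 1) mod m) c))"
    by (simp only: core_weight_def minus_apply root_comb_coroot[OF m i]) (simp add: fund_weight_def)
  also have "\<dots> = of_int (of_bool (i = 0) + cyc_count m c (int i - 1)
      - 2 * cyc_count m c (int i) + cyc_count m c (int i + 1))"
    by (simp add: cyc_count_def s)
  also have "\<dots> = of_int (int (card (addable_nodes m i c)) - int (card (removable_nodes m i c)))"
    by (simp only: card_addable_minus_removable[OF c i])
  finally show ?thesis by simp
qed

lemma res_count_core_reflection:
  assumes c: "flush m c" and i: "i < m"
  shows "real (res_count m j (core_reflection m i c)) = real (res_count m j c) +
    of_bool (j = i) * (real (card (addable_nodes m i c)) - real (card (removable_nodes m i c)))"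
proof -
  note p = flush_partition[OF c]
  let ?A = "addable_nodes m i c" and ?R = "removable_nodes m i c"
  have fin: "finite c" "finite ?A" using partition_finite[OF p] finite_addable_nodes[OF p i] by auto
  have R: "?R \<subseteq> {b \<in> c. residue m b = i}" by (auto simp: removable_nodes_def)
  then have cardR: "card ?R \<le> card {b \<in> c. residue m b = i}" using fin by (intro card_mono) auto
  have "{b \<in> c - ?R. residue m b = j} = (if j = i then {b \<in> c. residue m b = i} - ?R else {b \<in> c. residue m b = j})"
    using R by auto
  then have rem: "real (res_count m j (c - ?R)) = real (res_count m j c) - of_bool (j = i) * real (card ?R)"
    using R fin cardR by (simp add: res_count_def card_Diff_subset finite_subset[OF R] of_nat_diff)
  have A: "?A \<subseteq> {b. b \<notin> c \<and> residue m b = i}" by (auto simp: addable_nodes_def)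
  have "{b \<in> c \<union> ?A. residue m b = j} = (if j = i then {b \<in> c. residue m b = i} \<union> ?A else {b \<in> c. residue m b = j})"
    using A by auto
  moreover have "{b \<in> c. residue m b = i} \<inter> ?A = {}" using A by auto
  ultimately have add: "real (res_count m j (c \<union> ?A)) = real (res_count m j c) + of_bool (j = i) * real (card ?A)"
    using fin by (simp add: res_count_def card_Un_disjoint)
  show ?thesis
    using add rem flush_addable_or_removable[OF c, of i] nodes_empty_iff[OF p i]
    by (auto simp: core_reflection_def)
qed

lemma root_comb_add_single:
  assumes "i < m"
  shows "root_comb m (\<lambda>j. a j + of_bool (j = i) * t) = root_comb m a + t *\<^sub>w simple_root m i"
proof
  fix k
  have "(\<Sum>j<m. (a j + of_bool (j = i) * t) * simple_root m j k) =
      (\<Sum>j<m. a j * simple_root m j k + (if j = i then t * simple_root m j k else 0))"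
    by (rule sum.cong) (auto simp: algebra_simps)
  then show "root_comb m (\<lambda>j. a j + of_bool (j = i) * t) k = (root_comb m a + t *\<^sub>w simple_root m i) k"
    using assms unfolding root_comb_def plus_fun_apply sum_scale_apply
    by (simp add: sum.distrib scale_def)
qed

text \<open>The reflection $s_i$ changes only $a_i$, by the number of addable minus removable
  nodes, and this is the pairing of the weight with $\alpha_i^\vee$.\<close>

lemma core_weight_reflection:
  assumes c: "flush m c" and m: "m \<ge> 3" and i: "i < m"
  shows "core_weight m (core_reflection m i c) = simple_reflection m i (core_weight m c)"
  by (simp add: core_weight_def[of m "core_reflection m i c"] res_count_core_reflection[OF c i]
      root_comb_add_single[OF i] simple_reflection_def coroot_pairing_def
      core_weight_coroot[OF flush_partition[OF c] m i]) (simp add: core_weight_def)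

lemma flush_eqI_weight:
  assumes "flush m c" "flush m d" "m \<ge> 3" "core_weight m c = core_weight m d"
  shows "c = d"
proof (rule flush_eqI_res_count[OF assms(1,2)])
  fix i assume i: "i < m"
  have "root_comb m (\<lambda>j. real (res_count m j c)) = root_comb m (\<lambda>j. real (res_count m j d))"
    using assms(4) by (simp add: core_weight_def)
  from root_comb_eqD[OF assms(3) this i] show "res_count m i c = res_count m i d" by simp
qed (use assms in simp)

lemma core_weight_empty: "core_weight m {} = fund_weight 0"
proof -
  have "root_comb m (\<lambda>j. 0) = 0" by (rule ext) (simp add: root_comb_def sum_scale_apply)
  then show ?thesis by (simp add: core_weight_def res_count_def)
qed

section \<open>The affine Weyl group acting on the empty partition\<close>

lemma simple_reflection_apply: "simple_reflection m i x k = x k - x i * simple_root m i k"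
  by (simp add: simple_reflection_def coroot_pairing_def scale_def)

lemma simple_reflection_involution:
  assumes "i < m"
  shows "simple_reflection m i (simple_reflection m i x) = x"
  by (rule ext) (use assms in \<open>simp add: simple_reflection_apply simple_root_def cartan_def algebra_simps\<close>)

lemma simple_reflection_commute:
  assumes "i < m" "j < m" "cartan m i j = 0" "cartan m j i = 0"
  shows "simple_reflection m i (simple_reflection m j x) = simple_reflection m j (simple_reflection m i x)"
  by (rule ext) (use assms in \<open>simp add: simple_reflection_apply simple_root_def\<close>)

lemma simple_reflection_Bij:
  assumes "i < m"
  shows "simple_reflection m i \<in> Bij UNIV"
proof -
  have "bij (simple_reflection m i)"
    by (rule o_bij[of "simple_reflection m i"])
      (simp_all add: fun_eq_iff[of "_ \<circ> _"] simple_reflection_involution[OF assms])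
  then show ?thesis by (simp add: Bij_def extensional_def)
qed

lemma affine_weyl_group: "group (affine_weyl m)"
  unfolding affine_weyl_def by (rule group.group_subgroup_generated[OF group_BijGroup])

lemma affine_weyl_carrier_Bij: "carrier (affine_weyl m) \<subseteq> Bij UNIV"
  using group.carrier_subgroup_generated_subset[OF group_BijGroup, of UNIV]
  by (auto simp: affine_weyl_def BijGroup_def)

lemma affine_weyl_mult:
  assumes "v \<in> carrier (affine_weyl m)" "w \<in> carrier (affine_weyl m)"
  shows "(v \<otimes>\<^bsub>affine_weyl m\<^esub> w) x = v (w x)"
proof -
  have "v \<in> Bij UNIV" "w \<in> Bij UNIV" using assms affine_weyl_carrier_Bij by blast+
  then show ?thesis by (simp add: affine_weyl_def BijGroup_def compose_def)
qed

lemma affine_weyl_one: "\<one>\<^bsub>affine_weyl m\<^esub> x = x"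
  by (simp add: affine_weyl_def BijGroup_def)

lemma simple_reflection_carrier:
  assumes "i < m"
  shows "simple_reflection m i \<in> carrier (affine_weyl m)"
  unfolding affine_weyl_def carrier_subgroup_generated
  using simple_reflection_Bij[OF assms] assms by (intro generate.incl) (simp add: BijGroup_def)

lemma word_prod_affine_weyl:
  assumes "set is \<subseteq> {..<m}"
  shows "word_prod (affine_weyl m) (simple_reflection m) is \<in> carrier (affine_weyl m)"
    and "word_prod (affine_weyl m) (simple_reflection m) is x = foldr (simple_reflection m) is x"
proof -
  interpret group "affine_weyl m" by (rule affine_weyl_group)
  have "word_prod (affine_weyl m) (simple_reflection m) is \<in> carrier (affine_weyl m) \<and>
      word_prod (affine_weyl m) (simple_reflection m) is x = foldr (simple_reflection m) is x"
    using assms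
    by (induction "is") (simp_all add: word_prod_def affine_weyl_one simple_reflection_carrier affine_weyl_mult)
  then show "word_prod (affine_weyl m) (simple_reflection m) is \<in> carrier (affine_weyl m)"
    "word_prod (affine_weyl m) (simple_reflection m) is x = foldr (simple_reflection m) is x" by auto
qed

text \<open>The simple reflections are involutions, so no inverses are needed in words.\<close>

lemma affine_weyl_word:
  assumes "w \<in> carrier (affine_weyl m)"
  obtains "is" where "set is \<subseteq> {..<m}" "w = word_prod (affine_weyl m) (simple_reflection m) is"
proof -
  have *: "\<exists>is. set is \<subseteq> {..<m} \<and> (\<forall>x. w x = foldr (simple_reflection m) is x)"
    if "w \<in> generate (BijGroup UNIV) (carrier (BijGroup UNIV) \<inter> simple_reflection m ` {..<m})" for w
    using that
  proof (induction rule: generate.induct)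
    case one
    show ?case by (rule exI[of _ "[]"]) (simp add: BijGroup_def)
  next
    case (incl h)
    then obtain i where "i < m" "h = simple_reflection m i" by auto
    then show ?case by (intro exI[of _ "[i]"]) simp
  next
    case (inv h)
    then obtain i where i: "i < m" "h = simple_reflection m i" by auto
    have "inv\<^bsub>BijGroup UNIV\<^esub> h = h"
    proof (rule group.inv_equality[OF group_BijGroup])
      show "h \<otimes>\<^bsub>BijGroup UNIV\<^esub> h = \<one>\<^bsub>BijGroup UNIV\<^esub>"
        using simple_reflection_Bij[OF i(1)] simple_reflection_involution[OF i(1)] i(2)
        by (simp add: BijGroup_def compose_def restrict_def)
    qed (use simple_reflection_Bij[OF i(1)] i(2) in \<open>simp_all add: BijGroup_def\<close>)
    then show ?case using i by (intro exI[of _ "[i]"]) simp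
  next
    case (eng v w)
    then obtain iv iw where "set iv \<subseteq> {..<m}" "\<forall>x. v x = foldr (simple_reflection m) iv x"
      "set iw \<subseteq> {..<m}" "\<forall>x. w x = foldr (simple_reflection m) iw x" by blast
    moreover have "(v \<otimes>\<^bsub>BijGroup UNIV\<^esub> w) x = v (w x)" for x
      using affine_weyl_mult[of v m w] eng.hyps by (simp add: affine_weyl_def carrier_subgroup_generated)
    ultimately show ?case by (intro exI[of _ "iv @ iw"]) simp
  qed
  obtain "is" where "is": "set is \<subseteq> {..<m}" "\<forall>x. w x = foldr (simple_reflection m) is x"
    using *[of w] assms by (auto simp: affine_weyl_def carrier_subgroup_generated)
  then have "w = word_prod (affine_weyl m) (simple_reflection m) is"
    using word_prod_affine_weyl(2)[OF "is"(1)] by (intro ext) simp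
  with "is"(1) show thesis by (rule that)
qed

lemma core_word_weight:
  assumes "set is \<subseteq> {..<m}" "m \<ge> 3"
  shows "flush m (foldr (core_reflection m) is {}) \<and>
    core_weight m (foldr (core_reflection m) is {}) = foldr (simple_reflection m) is (fund_weight 0)"
  using assms
proof (induction "is")
  case Nil
  then show ?case by (simp add: flush_empty core_weight_empty)
next
  case (Cons i "is")
  then show ?case using core_reflection_flush[of m _ i] core_weight_reflection[of m _ i] by simp
qed

text \<open>Every word for \<open>w\<close> leads from the empty partition to a core of weight $w\Lambda_0$, and there is only one
  such core. Thus the action is well defined on the empty partition.\<close>

lemma core_action_empty_iff:
  assumes m: "m \<ge> 3" and w: "w \<in> carrier (affine_weyl m)"
  shows "core_action m w {} = c \<longleftrightarrow> flush m c \<and> core_weight m c = w (fund_weight 0)"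
proof -
  obtain "is" where "is": "set is \<subseteq> {..<m}" "w = word_prod (affine_weyl m) (simple_reflection m) is"
    using affine_weyl_word[OF w] by blast
  let ?d = "foldr (core_reflection m) is {}"
  have d: "flush m ?d" "core_weight m ?d = w (fund_weight 0)"
    using core_word_weight[OF "is"(1) m] word_prod_affine_weyl(2)[OF "is"(1)] "is"(2) by auto
  have "core_action m w {} = ?d"
    unfolding core_action_def
  proof (rule the_equality)
    fix e assume "\<exists>js. set js \<subseteq> {..<m} \<and> w = word_prod (affine_weyl m) (simple_reflection m) js \<and>
        e = foldr (core_reflection m) js {}"
    then obtain js where js: "set js \<subseteq> {..<m}" "w = word_prod (affine_weyl m) (simple_reflection m) js"
      "e = foldr (core_reflection m) js {}" by blast
    have "flush m e" "core_weight m e = w (fund_weight 0)"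
      using core_word_weight[OF js(1) m] word_prod_affine_weyl(2)[OF js(1)] js(2,3) by auto
    then show "e = ?d" using flush_eqI_weight d m by metis
  qed (use "is" in blast)
  then show ?thesis using d flush_eqI_weight m by metis
qed

section \<open>The affine Grassmannian of type $A_{2n}^{(2)}$\<close>

lemma A2_gen_carrier:
  assumes "n \<ge> 2" "i \<le> n"
  shows "A2_gen n i \<in> carrier (affine_weyl (2*n))"
proof -
  interpret group "affine_weyl (2*n)" by (rule affine_weyl_group)
  show ?thesis using assms by (auto simp: A2_gen_def intro!: m_closed simple_reflection_carrier)
qed

lemma A2_gen_apply:
  assumes "n \<ge> 2" "i \<le> n"
  shows "A2_gen n i x = (if i = 0 \<or> i = n then simple_reflection (2*n) i x
    else simple_reflection (2*n) i (simple_reflection (2*n) (2*n - i) x))"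
  using assms by (simp add: A2_gen_def affine_weyl_mult simple_reflection_carrier)

lemma A2_weyl_group: "group (A2_weyl n)"
  unfolding A2_weyl_def by (rule group.group_subgroup_generated[OF affine_weyl_group])

lemma A2_weyl_subset: "carrier (A2_weyl n) \<subseteq> carrier (affine_weyl (2*n))"
  unfolding A2_weyl_def by (rule group.carrier_subgroup_generated_subset[OF affine_weyl_group])

lemma A2_weyl_mult:
  assumes "v \<in> carrier (A2_weyl n)" "w \<in> carrier (A2_weyl n)"
  shows "(v \<otimes>\<^bsub>A2_weyl n\<^esub> w) x = v (w x)"
  using affine_weyl_mult[of v "2*n" w x] assms A2_weyl_subset by (auto simp: A2_weyl_def)

lemma A2_gen_weyl:
  assumes "n \<ge> 2" "i \<le> n"
  shows "A2_gen n i \<in> carrier (A2_weyl n)"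
  using A2_gen_carrier[OF assms] assms
  by (auto simp: A2_weyl_def carrier_subgroup_generated intro: generate.incl)

lemma A2_finite_weyl_subset: "carrier (A2_finite_weyl n) \<subseteq> carrier (A2_weyl n)"
proof -
  interpret group "affine_weyl (2*n)" by (rule affine_weyl_group)
  show ?thesis unfolding A2_weyl_def A2_finite_weyl_def carrier_subgroup_generated
    by (rule mono_generate) auto
qed

lemma A2_finite_weyl_fixes:
  assumes n: "n \<ge> 2" and w: "w \<in> carrier (A2_finite_weyl n)"
  shows "w (fund_weight 0) = fund_weight 0"
proof -
  interpret group "affine_weyl (2*n)" by (rule affine_weyl_group)
  have simple: "simple_reflection (2*n) i (fund_weight 0) = fund_weight 0" if "i > 0" for i
    using that by (intro ext) (simp add: simple_reflection_apply fund_weight_def)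
  have gen: "A2_gen n i (fund_weight 0) = fund_weight 0" if "1 \<le> i" "i \<le> n" for i
    using that n by (simp add: A2_gen_apply simple)
  have sub: "carrier (affine_weyl (2*n)) \<inter> A2_gen n ` {1..n} \<subseteq> carrier (affine_weyl (2*n))" by simp
  have "w \<in> generate (affine_weyl (2*n)) (carrier (affine_weyl (2*n)) \<inter> A2_gen n ` {1..n})"
    using w by (simp add: A2_finite_weyl_def carrier_subgroup_generated)
  then show ?thesis
  proof (induction rule: generate.induct)
    case one
    show ?case by (rule affine_weyl_one)
  next
    case (incl h)
    then show ?case using gen by auto
  next
    case (inv h)
    then have h: "h \<in> carrier (affine_weyl (2*n))" "h (fund_weight 0) = fund_weight 0" using gen by auto
    have "(inv\<^bsub>affine_weyl (2*n)\<^esub> h) (fund_weight 0) = (inv\<^bsub>affine_weyl (2*n)\<^esub> h) (h (fund_weight 0))"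
      by (simp only: h(2))
    also have "\<dots> = (inv\<^bsub>affine_weyl (2*n)\<^esub> h \<otimes>\<^bsub>affine_weyl (2*n)\<^esub> h) (fund_weight 0)"
      using affine_weyl_mult[of "inv\<^bsub>affine_weyl (2*n)\<^esub> h" "2*n" h "fund_weight 0"] h(1) by simp
    also have "\<dots> = fund_weight 0" using h(1) by (simp add: affine_weyl_one)
    finally show ?case .
  next
    case (eng v w)
    have "v \<in> carrier (affine_weyl (2*n))" "w \<in> carrier (affine_weyl (2*n))"
      using generate_in_carrier[OF sub] eng.hyps by blast+
    then show ?case using eng.IH by (simp add: affine_weyl_mult)
  qed
qed

text \<open>A shortest element of the coset of \<open>w0\<close> generates the same coset and agrees with \<open>w0\<close> on
  $\Lambda_0$, because the finite Weyl group fixes $\Lambda_0$.\<close>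

lemma A2_grassmannian_representative:
  assumes n: "n \<ge> 2" and w0: "w0 \<in> carrier (A2_weyl n)"
  obtains w where "w \<in> A2_grassmannian n" "w (fund_weight 0) = w0 (fund_weight 0)"
proof -
  interpret A: group "A2_weyl n" by (rule A2_weyl_group)
  interpret G: group "affine_weyl (2*n)" by (rule affine_weyl_group)
  interpret F: group "A2_finite_weyl n"
    unfolding A2_finite_weyl_def by (rule G.group_subgroup_generated)
  note sub = subsetD[OF A2_finite_weyl_subset]
  let ?C = "w0 <#\<^bsub>A2_weyl n\<^esub> carrier (A2_finite_weyl n)"
  have C: "?C = {w0 \<otimes>\<^bsub>A2_weyl n\<^esub> h | h. h \<in> carrier (A2_finite_weyl n)}"
    by (auto simp: l_coset_def)
  have mult: "h \<otimes>\<^bsub>A2_weyl n\<^esub> h' \<in> carrier (A2_finite_weyl n)"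
    if "h \<in> carrier (A2_finite_weyl n)" "h' \<in> carrier (A2_finite_weyl n)" for h h'
    using F.m_closed[OF that] by (simp add: A2_weyl_def A2_finite_weyl_def)
  have "w0 \<otimes>\<^bsub>A2_weyl n\<^esub> \<one>\<^bsub>A2_finite_weyl n\<^esub> \<in> ?C" unfolding C using F.one_closed by blast
  then obtain w where w: "w \<in> ?C" "\<And>v. v \<in> ?C \<Longrightarrow> A2_length n w \<le> A2_length n v"
    using ex_has_least_nat[of "\<lambda>v. v \<in> ?C" _ "A2_length n"] by blast
  then obtain h where h: "h \<in> carrier (A2_finite_weyl n)" "w = w0 \<otimes>\<^bsub>A2_weyl n\<^esub> h"
    unfolding C by blast
  have "w <#\<^bsub>A2_weyl n\<^esub> carrier (A2_finite_weyl n) \<subseteq> ?C"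
  proof
    fix v assume "v \<in> w <#\<^bsub>A2_weyl n\<^esub> carrier (A2_finite_weyl n)"
    then obtain h' where h': "h' \<in> carrier (A2_finite_weyl n)" "v = w \<otimes>\<^bsub>A2_weyl n\<^esub> h'"
      by (auto simp: l_coset_def)
    then have "v = w0 \<otimes>\<^bsub>A2_weyl n\<^esub> (h \<otimes>\<^bsub>A2_weyl n\<^esub> h')"
      using h w0 by (simp add: A.m_assoc sub)
    then show "v \<in> ?C" unfolding C using mult[OF h(1) h'(1)] by blast
  qed
  moreover have "w \<in> carrier (A2_weyl n)" using h w0 by (simp add: sub)
  ultimately have "w \<in> A2_grassmannian n" using w(2) by (auto simp: A2_grassmannian_def)
  moreover have "w (fund_weight 0) = w0 (fund_weight 0)"
    using h w0 A2_finite_weyl_fixes[OF n h(1)] by (simp add: A2_weyl_mult sub)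
  ultimately show thesis by (rule that)
qed

section \<open>Self-conjugate cores\<close>

lemma residue_swap:
  assumes "m > 0"
  shows "residue m (prod.swap b) = (m - residue m b) mod m"
proof -
  obtain x y where b: "b = (x, y)" by (cases b)
  define z where "z = int y - int x"
  have r: "int (residue m b) = z mod int m" using assms by (simp add: residue_def b z_def)
  have "int (residue m (prod.swap b)) = (- z) mod int m" using assms by (simp add: residue_def b z_def)
  also have "\<dots> = (int m - z mod int m) mod int m" by (simp add: mod_simps)
  also have "\<dots> = int ((m - residue m b) mod m)"
  proof -
    have "residue m b \<le> m" using r assms by (metis of_nat_le_iff of_nat_0_less_iff pos_mod_bound less_imp_le)
    then show ?thesis by (simp add: r[symmetric] zmod_int of_nat_diff)
  qed
  finally show ?thesis by (simp only: of_nat_eq_iff)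
qed

lemma partition_swap:
  assumes "is_partition c"
  shows "is_partition (prod.swap ` c)"
  unfolding is_partition_def
proof (intro conjI ballI)
  show "finite (prod.swap ` c)" using assms by (simp add: is_partition_def)
  fix b assume "b \<in> prod.swap ` c"
  then obtain x y where b: "b = (y, x)" "(x, y) \<in> c" by auto
  have "(i', j') \<in> prod.swap ` c" if "i' \<le> y" "j' \<le> x" for i' j'
    using partition_down[OF assms b(2) that(2,1)] by (intro image_eqI[of _ _ "(j', i')"]) simp_all
  then show "case b of (i, j) \<Rightarrow> \<forall>i'\<le>i. \<forall>j'\<le>j. (i', j') \<in> prod.swap ` c"
    by (simp add: b(1))
qed

lemma swap_swap_image: "prod.swap ` prod.swap ` c = c"
  by (simp add: image_image)

lemma dual_residue_dual: "i < m \<Longrightarrow> (m - (m - i) mod m) mod m = (i :: nat)"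
  by (cases "i = 0") auto

lemma swap_nodes_subset:
  assumes "i < m"
  shows "prod.swap ` removable_nodes m i c \<subseteq> removable_nodes m ((m - i) mod m) (prod.swap ` c)"
    and "prod.swap ` addable_nodes m i c \<subseteq> addable_nodes m ((m - i) mod m) (prod.swap ` c)"
proof -
  have "prod.swap ` c - {prod.swap b} = prod.swap ` (c - {b})" for b
    by (simp add: image_set_diff inj_swap)
  then show "prod.swap ` removable_nodes m i c \<subseteq> removable_nodes m ((m - i) mod m) (prod.swap ` c)"
    using assms by (auto simp: removable_nodes_def residue_swap partition_swap simp del: swap_simp)
  show "prod.swap ` addable_nodes m i c \<subseteq> addable_nodes m ((m - i) mod m) (prod.swap ` c)"
  proof (rule image_subsetI)
    fix b assume "b \<in> addable_nodes m i c"
    then show "prod.swap b \<in> addable_nodes m ((m - i) mod m) (prod.swap ` c)"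
      using assms partition_swap[of "insert b c"] inj_image_mem_iff[OF inj_swap, of b c]
      by (simp add: addable_nodes_def residue_swap)
  qed
qed

lemma swap_nodes:
  assumes i: "i < m"
  shows "removable_nodes m ((m - i) mod m) (prod.swap ` c) = prod.swap ` removable_nodes m i c"
    and "addable_nodes m ((m - i) mod m) (prod.swap ` c) = prod.swap ` addable_nodes m i c"
proof -
  have i': "(m - i) mod m < m" using i by simp
  show "removable_nodes m ((m - i) mod m) (prod.swap ` c) = prod.swap ` removable_nodes m i c"
    using swap_nodes_subset(1)[OF i, of c] image_mono[OF swap_nodes_subset(1)[OF i', of "prod.swap ` c"], of prod.swap]
    by (simp add: swap_swap_image dual_residue_dual[OF i])
  show "addable_nodes m ((m - i) mod m) (prod.swap ` c) = prod.swap ` addable_nodes m i c"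
    using swap_nodes_subset(2)[OF i, of c] image_mono[OF swap_nodes_subset(2)[OF i', of "prod.swap ` c"], of prod.swap]
    by (simp add: swap_swap_image dual_residue_dual[OF i])
qed

text \<open>Conjugation of partitions induces the diagram automorphism $i \mapsto -i$ of residues modulo \<open>m\<close>.\<close>

lemma core_reflection_swap:
  assumes "i < m"
  shows "core_reflection m ((m - i) mod m) (prod.swap ` c) = prod.swap ` core_reflection m i c"
  by (simp add: core_reflection_def swap_nodes[OF assms] image_Un image_set_diff inj_swap)

lemma res_count_swap:
  assumes i: "i < m"
  shows "res_count m ((m - i) mod m) (prod.swap ` c) = res_count m i c"
proof -
  have "residue m b < m" for b using i by (cases b) (simp add: residue_def nat_less_iff)
  then have iff: "residue m (prod.swap b) = (m - i) mod m \<longleftrightarrow> residue m b = i" for b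
    using i by (metis residue_swap dual_residue_dual gr_implies_not0 neq0_conv)
  have "{b \<in> prod.swap ` c. residue m b = (m - i) mod m} = prod.swap ` {b \<in> c. residue m b = i}"
    using iff by (auto simp del: swap_simp)
  then show ?thesis by (simp add: res_count_def card_image)
qed

text \<open>A box with the largest sum of coordinates has no neighbour below or to its right.\<close>

lemma nonempty_partition_removable:
  assumes c: "is_partition c" "c \<noteq> {}"
  obtains b where "b \<in> c" "is_partition (c - {b})"
proof -
  obtain b where b: "b \<in> c" "\<And>b'. b' \<in> c \<Longrightarrow> fst b' + snd b' \<le> fst b + snd b"
    using finite_has_maximal[of "(\<lambda>b. fst b + snd b) ` c"] partition_finite[OF c(1)] c(2)
    by (metis (no_types, lifting) Max_ge Max_in finite_imageI image_eqI image_iff image_is_empty)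
  have "is_partition (c - {b})"
    unfolding is_partition_steps
  proof (intro conjI allI impI)
    show "finite (c - {b})" using partition_finite[OF c(1)] by simp
    fix x y
    show "(x, y) \<in> c - {b}" if "(Suc x, y) \<in> c - {b}"
      using that b(2)[of "(Suc x, y)"] partition_down[OF c(1), of "Suc x" y x y] by auto
    show "(x, y) \<in> c - {b}" if "(x, Suc y) \<in> c - {b}"
      using that b(2)[of "(x, Suc y)"] partition_down[OF c(1), of x "Suc y" x y] by auto
  qed
  with b(1) show thesis by (rule that)
qed

lemma removable_iff_weight_neg:
  assumes c: "flush m c" and m: "m \<ge> 3" and i: "i < m"
  shows "removable_nodes m i c \<noteq> {} \<longleftrightarrow> core_weight m c i < 0"
proof -
  note p = flush_partition[OF c]
  have "finite (removable_nodes m i c)" using partition_finite[OF p] by (simp add: removable_nodes_def)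
  then have "removable_nodes m i c \<noteq> {} \<longleftrightarrow> card (removable_nodes m i c) > 0" by (simp add: card_gt_0_iff)
  moreover have "addable_nodes m i c = {} \<or> removable_nodes m i c = {}"
    using flush_addable_or_removable[OF c] nodes_empty_iff[OF p i] by blast
  ultimately show ?thesis by (auto simp: core_weight_coroot[OF p m i])
qed

lemma card_core_reflection_less:
  assumes "finite c" "removable_nodes m i c \<noteq> {}"
  shows "card (core_reflection m i c) < card c"
  using assms by (auto simp: core_reflection_def removable_nodes_def intro!: psubset_card_mono)

text \<open>Induction on the number of boxes. A nonempty self-conjugate core has a removable node of some residue
  \<open>i\<close>, and by symmetry one of residue \<open>-i\<close>, so \<open>i \<le> n\<close> may be assumed. If \<open>i\<close> is \<open>0\<close> or
  \<open>n\<close> the reflection $s_i$ keeps the core self-conjugate. Otherwise $s_i$ and $s_{2n-i}$ commute, and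
  applying both keeps it self-conjugate. In either case the core gets smaller.\<close>

lemma self_conjugate_weight_reached:
  assumes n: "n \<ge> 2" and c: "flush (2*n) c" and sc: "prod.swap ` c = c"
  shows "\<exists>w \<in> carrier (A2_weyl n). w (fund_weight 0) = core_weight (2*n) c"
  using c sc
proof (induction "card c" arbitrary: c rule: less_induct)
  case less
  let ?m = "2*n"
  interpret A: group "A2_weyl n" by (rule A2_weyl_group)
  have m: "?m \<ge> 3" using n by simp
  note c = less.prems(1) and p = flush_partition[OF less.prems(1)]
  show ?case
  proof (cases "c = {}")
    case True
    have "\<one>\<^bsub>A2_weyl n\<^esub> (fund_weight 0) = fund_weight 0" by (simp add: A2_weyl_def affine_weyl_one)
    then show ?thesis using True by (intro bexI[of _ "\<one>\<^bsub>A2_weyl n\<^esub>"]) (simp_all add: core_weight_empty)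
  next
    case False
    obtain b where b: "b \<in> c" "is_partition (c - {b})" using nonempty_partition_removable[OF p False] by blast
    define i0 where "i0 = residue ?m b"
    have i0: "i0 < ?m" using n by (cases b) (simp add: i0_def residue_def nat_less_iff)
    have "b \<in> removable_nodes ?m i0 c" using b by (simp add: removable_nodes_def i0_def)
    then have rem0: "removable_nodes ?m i0 c \<noteq> {}" by blast
    have dual: "removable_nodes ?m ((?m - j) mod ?m) c \<noteq> {}" if "removable_nodes ?m j c \<noteq> {}" "j < ?m" for j
      using swap_nodes(1)[OF that(2), of c] that(1) less.prems(2) by auto
    obtain i where i: "i \<le> n" "removable_nodes ?m i c \<noteq> {}"
    proof (cases "i0 \<le> n")
      case True
      then show thesis using that rem0 by blast
    next
      case False
      then have "(?m - i0) mod ?m \<le> n" using i0 by simp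
      then show thesis using that dual[OF rem0 i0] by blast
    qed
    have im: "i < ?m" using i n by simp
    have wt_neg: "core_weight ?m c i < 0"
      using i removable_iff_weight_neg[OF c m im] by simp
    have IH: "\<exists>w \<in> carrier (A2_weyl n). w (fund_weight 0) = core_weight ?m c"
      if d: "flush ?m d" "prod.swap ` d = d" "card d < card c"
        and w: "A2_gen n i (core_weight ?m d) = core_weight ?m c" for d
    proof -
      obtain w where "w \<in> carrier (A2_weyl n)" "w (fund_weight 0) = core_weight ?m d"
        using less.hyps[OF d(3,1,2)] by blast
      then show ?thesis using w A2_gen_weyl[OF n i(1)]
        by (intro bexI[of _ "A2_gen n i \<otimes>\<^bsub>A2_weyl n\<^esub> w"]) (simp_all add: A2_weyl_mult)
    qed
    show ?thesis
    proof (cases "i = 0 \<or> i = n")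
      case True
      let ?d = "core_reflection ?m i c"
      have "(?m - i) mod ?m = i" using True n by auto
      then have "prod.swap ` ?d = ?d" using core_reflection_swap[OF im, of c] less.prems(2) by simp
      moreover have "flush ?m ?d" using core_reflection_flush[OF c im] n by simp
      moreover have "A2_gen n i (core_weight ?m ?d) = core_weight ?m c"
        using True by (simp add: A2_gen_apply[OF n i(1)] core_weight_reflection[OF c m im] simple_reflection_involution im)
      ultimately show ?thesis
        using IH card_core_reflection_less[OF partition_finite[OF p] i(2)] by blast
    next
      case False
      define j where "j = ?m - i"
      have jm: "j < ?m" and ij: "(?m - i) mod ?m = j" "(?m - j) mod ?m = i"
        using False i n by (auto simp: j_def)
      have cart: "cartan ?m i j = 0" "cartan ?m j i = 0"
      proof -
        have "i + 1 < ?m" "i \<noteq> j" "j \<noteq> i + 1" "i \<noteq> j + 1" "j > 0" using False i n by (auto simp: j_def)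
        moreover have "(j + 1) mod ?m = (if j + 1 = ?m then 0 else j + 1)" using jm by (simp add: mod_Suc)
        ultimately show "cartan ?m i j = 0" "cartan ?m j i = 0" using False by (auto simp: cartan_def)
      qed
      note comm = simple_reflection_commute[OF im jm cart]
      let ?d = "core_reflection ?m j c" let ?e = "core_reflection ?m i ?d"
      let ?d' = "core_reflection ?m i c" let ?e' = "core_reflection ?m j ?d'"
      have fl: "flush ?m ?d" "flush ?m ?d'" using core_reflection_flush[OF c] im jm n by auto
      have fl2: "flush ?m ?e" "flush ?m ?e'" using core_reflection_flush fl im jm n by auto
      have wt: "core_weight ?m ?d = simple_reflection ?m j (core_weight ?m c)"
        "core_weight ?m ?e = simple_reflection ?m i (simple_reflection ?m j (core_weight ?m c))"
        "core_weight ?m ?e' = simple_reflection ?m j (simple_reflection ?m i (core_weight ?m c))"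
        using core_weight_reflection[OF c m] core_weight_reflection[OF fl(1) m] core_weight_reflection[OF fl(2) m] im jm
        by auto
      \<comment> \<open>Conjugation exchanges the orders in which the two reflections are applied.\<close>
      have "?e' = ?e" by (rule flush_eqI_weight[OF fl2(2,1) m]) (simp add: wt comm)
      moreover have "prod.swap ` ?e = ?e'"
        using core_reflection_swap[OF im, of ?d] core_reflection_swap[OF jm, of c] less.prems(2) ij by simp
      ultimately have "prod.swap ` ?e = ?e" by simp
      moreover have "card ?e < card c"
      proof -
        \<comment> \<open>The reflection in \<open>j\<close> does not affect the pairing with the coroot at \<open>i\<close>.\<close>
        have "core_weight ?m ?d i = core_weight ?m c i"
          using cart im by (simp add: wt simple_reflection_apply simple_root_def)
        then have "removable_nodes ?m i ?d \<noteq> {}"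
          using wt_neg removable_iff_weight_neg[OF fl(1) m im] by simp
        then have "card ?e < card ?d"
          by (rule card_core_reflection_less[OF partition_finite[OF flush_partition[OF fl(1)]]])
        also have "card ?d < card c"
          using dual[OF i(2) im] ij by (intro card_core_reflection_less[OF partition_finite[OF p]]) simp
        finally show ?thesis .
      qed
      moreover have "A2_gen n i (core_weight ?m ?e) = core_weight ?m c"
        using False i n by (simp add: A2_gen_apply wt j_def[symmetric] comm simple_reflection_involution im jm)
      ultimately show ?thesis using IH fl2(1) by blast
    qed
  qed
qed

section \<open>The atomic length\<close>

lemma sum_symmetric_pairs:
  fixes f :: "nat \<Rightarrow> real"
  assumes "n \<ge> 1"
  shows "(\<Sum>j<2*n. f j) = f 0 + (\<Sum>i\<in>{1..<n}. f i + f (2*n - i)) + f n"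
proof -
  have "{..<2*n} = insert 0 (insert n ({1..<n} \<union> {n+1..<2*n}))" using assms by auto
  then have "(\<Sum>j<2*n. f j) = f 0 + f n + (\<Sum>i\<in>{1..<n} \<union> {n+1..<2*n}. f i)"
    using assms by simp
  also have "(\<Sum>i\<in>{1..<n} \<union> {n+1..<2*n}. f i) = (\<Sum>i\<in>{1..<n}. f i) + (\<Sum>i\<in>{n+1..<2*n}. f i)"
    by (rule sum.union_disjoint) auto
  also have "(\<Sum>i\<in>{n+1..<2*n}. f i) = (\<Sum>i\<in>{1..<n}. f (2*n - i))"
    by (rule sum.reindex_bij_witness[of _ "\<lambda>i. 2*n - i" "\<lambda>i. 2*n - i"]) auto
  finally show ?thesis by (simp add: sum.distrib)
qed

lemma sum_ends:
  fixes g :: "nat \<Rightarrow> real"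
  assumes "n \<ge> 1"
  shows "(\<Sum>i=0..n. g i) = g 0 + (\<Sum>i\<in>{1..<n}. g i) + g n"
proof -
  have "{0..n} = insert 0 (insert n {1..<n})" using assms by auto
  then show ?thesis using assms by simp
qed

text \<open>The coefficients, in the simple roots of type $A_{2n-1}^{(1)}$, of the combination of the simple roots of
  type $A_{2n}^{(2)}$ with coefficients \<open>a\<close>.\<close>

definition unfold_coeffs :: "nat \<Rightarrow> (nat \<Rightarrow> real) \<Rightarrow> nat \<Rightarrow> real" where
  "unfold_coeffs n a j = (if j < n then a j else if j = n then 2 * a n else a (2*n - j))"

lemma A2_root_sum:
  assumes "n \<ge> 1"
  shows "(\<Sum>i=0..n. a i *\<^sub>w A2_root n i) = root_comb (2*n) (unfold_coeffs n a)"
proof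
  fix k
  have "(\<Sum>i\<in>{1..<n}. a i * A2_root n i k) =
      (\<Sum>i\<in>{1..<n}. unfold_coeffs n a i * simple_root (2*n) i k
        + unfold_coeffs n a (2*n - i) * simple_root (2*n) (2*n - i) k)"
    by (rule sum.cong) (auto simp: unfold_coeffs_def A2_root_def algebra_simps)
  then show "(\<Sum>i=0..n. a i *\<^sub>w A2_root n i) k = root_comb (2*n) (unfold_coeffs n a) k"
    unfolding root_comb_def sum_scale_apply sum_symmetric_pairs[OF assms] sum_ends[OF assms]
    using assms by (simp add: unfold_coeffs_def A2_root_def scale_def)
qed

lemma card_eq_sum_res_count:
  assumes "finite c" "m > 0"
  shows "card c = (\<Sum>j<m. res_count m j c)"
proof -
  have "residue m b < m" for b using assms by (cases b) (simp add: residue_def nat_less_iff)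
  then have "c = (\<Union>j<m. {b \<in> c. residue m b = j})" by auto
  then have "card c = card (\<Union>j<m. {b \<in> c. residue m b = j})" by simp
  also have "\<dots> = (\<Sum>j<m. res_count m j c)"
    unfolding res_count_def by (rule card_UN_disjoint) (use assms in auto)
  finally show ?thesis .
qed

theorem proposition5p6:
  fixes n :: nat and c :: "box set"
  assumes "n \<ge> 2" and "c \<in> self_conjugate_cores (2*n)"
  shows "A2_atomic_length n c = 1/2 * (real (card c) + real (res_count (2*n) 0 c))"
proof -
  let ?m = "2*n"
  define r where "r j = real (res_count ?m j c)" for j
  \<comment> \<open>The half comes from the simple root $2\alpha_n$.\<close>
  define a where "a i = (if i = n then r n / 2 else r i)" for i
  have m: "?m \<ge> 3" and n1: "n \<ge> 1" using assms(1) by auto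
  have c: "flush ?m c" and sc: "prod.swap ` c = c"
    using assms(2) cores_flush by (auto simp: self_conjugate_cores_def self_conjugate_def)
  have sym: "r (?m - j) = r j" if "0 < j" "j < ?m" for j
    using res_count_swap[of j ?m c] that sc by (simp add: r_def)
  have unf: "unfold_coeffs n a j = r j" if "j < ?m" for j
    using that sym[of j] by (auto simp: unfold_coeffs_def a_def)
  have total: "real (card c) = r 0 + 2 * (\<Sum>i\<in>{1..<n}. r i) + r n"
  proof -
    have "real (card c) = (\<Sum>j<?m. r j)"
      using card_eq_sum_res_count[of c ?m] partition_finite[OF flush_partition[OF c]] n1 by (simp add: r_def)
    also have "\<dots> = r 0 + (\<Sum>i\<in>{1..<n}. r i + r (?m - i)) + r n" by (rule sum_symmetric_pairs[OF n1])
    also have "(\<Sum>i\<in>{1..<n}. r i + r (?m - i)) = (\<Sum>i\<in>{1..<n}. 2 * r i)"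
      by (rule sum.cong) (auto simp: sym)
    also have "\<dots> = 2 * (\<Sum>i\<in>{1..<n}. r i)" by (rule sum_distrib_left[symmetric])
    finally show ?thesis .
  qed
  have inner: "(\<Sum>i\<in>{1..<n}. a i) = (\<Sum>i\<in>{1..<n}. r i)" by (rule sum.cong) (auto simp: a_def)
  have atomic: "(\<Sum>i=0..n. a i) = 1/2 * (real (card c) + real (res_count ?m 0 c))"
    unfolding sum_ends[OF n1] inner total using n1 by (simp add: a_def r_def[of 0, symmetric])
  have coeffs: "(\<forall>j<?m. unfold_coeffs n b j = r j) \<longleftrightarrow>
      A2_fund_weight0 - w A2_fund_weight0 = (\<Sum>i=0..n. b i *\<^sub>w A2_root n i)"
    if "w (fund_weight 0) = core_weight ?m c" for w :: "weight \<Rightarrow> weight" and b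
  proof -
    have "A2_fund_weight0 - w A2_fund_weight0 = root_comb ?m r"
      using that by (simp add: A2_fund_weight0_def core_weight_def r_def[abs_def])
    moreover have "root_comb ?m r = root_comb ?m (unfold_coeffs n b) \<longleftrightarrow> (\<forall>j<?m. unfold_coeffs n b j = r j)"
      using root_comb_eqD[OF m, of r "unfold_coeffs n b"] by (auto simp: root_comb_def)
    ultimately show ?thesis by (simp add: A2_root_sum[OF n1])
  qed
  have grass: "w \<in> carrier (affine_weyl ?m)" if "w \<in> A2_grassmannian n" for w
    using that A2_weyl_subset by (auto simp: A2_grassmannian_def)
  obtain w where w: "w \<in> A2_grassmannian n" "w (fund_weight 0) = core_weight ?m c"
    using self_conjugate_weight_reached[OF assms(1) c sc] A2_grassmannian_representative[OF assms(1)] by metis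
  show ?thesis
    unfolding A2_atomic_length_def
  proof (rule the_equality)
    have "core_action ?m w {} = c" using core_action_empty_iff[OF m grass[OF w(1)]] c w(2) by simp
    moreover have "A2_fund_weight0 - w A2_fund_weight0 = (\<Sum>i=0..n. a i *\<^sub>w A2_root n i)"
      using coeffs[of w a, OF w(2)] unf by blast
    ultimately show "\<exists>w\<in>A2_grassmannian n. core_action ?m w {} = c \<and>
        (\<exists>a. A2_fund_weight0 - w A2_fund_weight0 = (\<Sum>i=0..n. a i *\<^sub>w A2_root n i) \<and>
          1/2 * (real (card c) + real (res_count ?m 0 c)) = (\<Sum>i=0..n. a i))"
      using w(1) atomic by metis
  next
    fix l assume "\<exists>w\<in>A2_grassmannian n. core_action ?m w {} = c \<and>
        (\<exists>a. A2_fund_weight0 - w A2_fund_weight0 = (\<Sum>i=0..n. a i *\<^sub>w A2_root n i) \<and> l = (\<Sum>i=0..n. a i))"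
    then obtain v b where v: "v \<in> A2_grassmannian n" "core_action ?m v {} = c"
      and b: "A2_fund_weight0 - v A2_fund_weight0 = (\<Sum>i=0..n. b i *\<^sub>w A2_root n i)" "l = (\<Sum>i=0..n. b i)"
      by blast
    have "v (fund_weight 0) = core_weight ?m c" using core_action_empty_iff[OF m grass[OF v(1)], of c] v(2) by metis
    then have u: "unfold_coeffs n b j = r j" if "j < ?m" for j using coeffs[of v b] b(1) that by blast
    have "b i = a i" if "i \<le> n" for i
      using u[of i] that n1 by (auto simp: unfold_coeffs_def a_def split: if_splits)
    then show "l = 1/2 * (real (card c) + real (res_count ?m 0 c))"
      using b(2) atomic by simp
  qed
qed

end
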